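(* Let $G$ be an abelian group and $\mathcal{D}$ a finite-dimensional simple real algebra. Any division $G$-grading on $\mathcal{D}$ with homogeneous components of dimension $4$ is the product grading of the trivial grading on the neutral homogeneous component $\mathcal{D}_e$ and a division $G$-grading with homogeneous components of dimension $1$ on the centralizer $C_{\mathcal{D}}(\mathcal{D}_e)$. (That is, $C_{\mathcal{D}}(\mathcal{D}_e)$ is a graded subalgebra of $\mathcal{D}$, its induced $G$-grading is a division grading with homogeneous components of dimension $1$, and the natural map $\mathcal{D}_e\otimes C_{\mathcal{D}}(\mathcal{D}_e)\to\mathcal{D}$, $x\otimes y\mapsto xy$, is an isomorphism of graded algebras, where $\mathcal{D}_e$ is trivially graded.)
   Context: Algebras are associative; dimensions and tensor products are over $\mathbb{R}$. A $G$-grading on an algebra $\mathcal{D}$ is a decomposition $\mathcal{D}=\bigoplus_{g\in G}\mathcal{D}_g$ into subspaces with $\mathcal{D}_g\mathcal{D}_h\subseteq\mathcal{D}_{gh}$; $e$ is the neutral element of $G$. It is a division grading if $\mathcal{D}$ is unital and every nonzero homogeneous element is invertible; then all nonzero homogeneous components have the same dimension ("homogeneous components of dimension $d$" refers to the nonzero ones). A subalgebra $\mathcal{F}$ is graded if $\mathcal{F}=\bigoplus_{g}(\mathcal{D}_g\cap\mathcal{F})$, and then it carries the induced grading $\mathcal{F}_g=\mathcal{D}_g\cap\mathcal{F}$. Product grading: if $\mathcal{D}$ is $G$-graded and $\mathcal{D}'$ is $H$-graded, $\mathcal{D}\otimes\mathcal{D}'$ is $G\times H$-graded by $(\mathcal{D}\otimes\mathcal{D}')_{(g,h)}=\mathcal{D}_g\otimes\mathcal{D}'_h$;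 when the first factor is graded by the trivial group, $\{e\}\times G$ is identified with $G$. $C_{\mathcal{D}}(\mathcal{D}_e)$ denotes the centralizer of $\mathcal{D}_e$ in $\mathcal{D}$. *)

theory Defs
  imports "HOL-Analysis.Analysis" "HOL-Analysis.Finite_Function_Topology"
begin

section \<open>The tensor product of real vector spaces and of real algebras\<close>

text \<open>
  The free real vector space on \<open>'a \<times> 'b\<close> is \<open>('a \<times> 'b) \<Rightarrow>\<^sub>0 real\<close>, and the tensor
  product is its quotient by the span of the bilinearity relators.
\<close>

definition tensor_relators :: "(('a::real_vector \<times> 'b::real_vector) \<Rightarrow>\<^sub>0 real) set" where
  "tensor_relators =
     {Poly_Mapping.single (x + x', y) 1 - Poly_Mapping.single (x, y) 1
        - Poly_Mapping.single (x', y) 1 | x x' y. True} \<union>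
     {Poly_Mapping.single (x, y + y') 1 - Poly_Mapping.single (x, y) 1
        - Poly_Mapping.single (x, y') 1 | x y y'. True} \<union>
     {Poly_Mapping.single (r *\<^sub>R x, y) 1 - r *\<^sub>R Poly_Mapping.single (x, y) 1 | r x y. True} \<union>
     {Poly_Mapping.single (x, r *\<^sub>R y) 1 - r *\<^sub>R Poly_Mapping.single (x, y) 1 | r x y. True}"

definition tensor_eq ::
  "(('a::real_vector \<times> 'b::real_vector) \<Rightarrow>\<^sub>0 real) \<Rightarrow> (('a \<times> 'b) \<Rightarrow>\<^sub>0 real) \<Rightarrow> bool" where
  "tensor_eq F F' \<longleftrightarrow> F - F' \<in> span tensor_relators"

quotient_type (overloaded) ('a, 'b) tensor =
  "('a::real_vector \<times> 'b::real_vector) \<Rightarrow>\<^sub>0 real" / tensor_eq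
proof (rule equivpI)
  show "reflp (tensor_eq :: (('a \<times> 'b) \<Rightarrow>\<^sub>0 real) \<Rightarrow> _)"
    by (simp add: reflp_def tensor_eq_def span_zero)
  show "symp (tensor_eq :: (('a \<times> 'b) \<Rightarrow>\<^sub>0 real) \<Rightarrow> _)"
    unfolding symp_def tensor_eq_def by (metis minus_diff_eq span_neg)
  show "transp (tensor_eq :: (('a \<times> 'b) \<Rightarrow>\<^sub>0 real) \<Rightarrow> _)"
  proof (rule transpI)
    fix x y z :: "('a \<times> 'b) \<Rightarrow>\<^sub>0 real"
    assume "tensor_eq x y" "tensor_eq y z"
    then have "(x - y) + (y - z) \<in> span tensor_relators"
      unfolding tensor_eq_def by (rule span_add)
    then show "tensor_eq x z" by (simp add: tensor_eq_def)
  qed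
qed

instantiation tensor :: (real_vector, real_vector) real_vector
begin

lift_definition zero_tensor :: "('a, 'b) tensor" is 0 .

lift_definition plus_tensor :: "('a, 'b) tensor \<Rightarrow> ('a, 'b) tensor \<Rightarrow> ('a, 'b) tensor" is "(+)"
  unfolding tensor_eq_def by (metis add_diff_add span_add)

lift_definition uminus_tensor :: "('a, 'b) tensor \<Rightarrow> ('a, 'b) tensor" is uminus
  unfolding tensor_eq_def by (metis minus_diff_minus span_neg)

lift_definition minus_tensor :: "('a, 'b) tensor \<Rightarrow> ('a, 'b) tensor \<Rightarrow> ('a, 'b) tensor" is "(-)"
proof -
  fix a b c d :: "('a \<times> 'b) \<Rightarrow>\<^sub>0 real"
  assume "tensor_eq a b" "tensor_eq c d"
  then have "(a - b) - (c - d) \<in> span tensor_relators"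
    unfolding tensor_eq_def by (rule span_diff)
  then show "tensor_eq (a - c) (b - d)" by (simp add: tensor_eq_def algebra_simps)
qed

lift_definition scaleR_tensor :: "real \<Rightarrow> ('a, 'b) tensor \<Rightarrow> ('a, 'b) tensor" is scaleR
  unfolding tensor_eq_def by (metis scaleR_right_diff_distrib span_scale)

instance
proof
  fix a b c :: "('a, 'b) tensor" and r s :: real
  show "a + b + c = a + (b + c)"
    by transfer (simp add: tensor_eq_def span_zero add.assoc)
  show "a + b = b + a"
    by transfer (simp add: tensor_eq_def span_zero add.commute)
  show "0 + a = a" by transfer (simp add: tensor_eq_def span_zero)
  show "- a + a = 0" by transfer (simp add: tensor_eq_def span_zero)
  show "a - b = a + - b" by transfer (simp add: tensor_eq_def span_zero)
  show "r *\<^sub>R (a + b) = r *\<^sub>R a + r *\<^sub>R b"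
    by transfer (simp add: tensor_eq_def span_zero scaleR_add_right)
  show "(r + s) *\<^sub>R a = r *\<^sub>R a + s *\<^sub>R a"
    by transfer (simp add: tensor_eq_def span_zero scaleR_add_left)
  show "r *\<^sub>R s *\<^sub>R a = (r * s) *\<^sub>R a" by transfer (simp add: tensor_eq_def span_zero)
  show "1 *\<^sub>R a = a" by transfer (simp add: tensor_eq_def span_zero)
qed

end

lift_definition tens :: "'a::real_vector \<Rightarrow> 'b::real_vector \<Rightarrow> ('a, 'b) tensor"
  is "\<lambda>x y. Poly_Mapping.single (x, y) 1" .

lemma bilinear_tens: "bilinear tens"
  unfolding bilinear_def
proof (intro conjI allI linearI)
  fix x x' :: 'a and y y' :: 'b and r :: real
  show "tens x (y + y') = tens x y + tens x y'"
    by transfer (simp only: tensor_eq_def diff_diff_eq[symmetric], rule span_base,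
        unfold tensor_relators_def, blast)
  show "tens (x + x') y = tens x y + tens x' y"
    by transfer (simp only: tensor_eq_def diff_diff_eq[symmetric], rule span_base,
        unfold tensor_relators_def, blast)
  show "tens x (r *\<^sub>R y) = r *\<^sub>R tens x y"
    by transfer (simp only: tensor_eq_def, rule span_base, unfold tensor_relators_def, blast)
  show "tens (r *\<^sub>R x) y = r *\<^sub>R tens x y"
    by transfer (simp only: tensor_eq_def, rule span_base, unfold tensor_relators_def, blast)
qed

definition free_extend :: "('k \<Rightarrow> 'c::real_vector) \<Rightarrow> ('k \<Rightarrow>\<^sub>0 real) \<Rightarrow> 'c" where
  "free_extend f F = (\<Sum>k\<in>Poly_Mapping.keys F. Poly_Mapping.lookup F k *\<^sub>R f k)"

lemma lookup_scaleR [simp]: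
  fixes F :: "'k \<Rightarrow>\<^sub>0 real"
  shows "Poly_Mapping.lookup (r *\<^sub>R F) k = r * Poly_Mapping.lookup F k"
proof -
  have "finite {k. r * Poly_Mapping.lookup F k \<noteq> 0}"
    by (rule finite_subset[OF _ finite_keys[of F]]) (auto simp: in_keys_iff)
  then show ?thesis by (simp add: scaleR_poly_mapping_def)
qed

lemma free_extend_superset:
  assumes "finite A" "Poly_Mapping.keys F \<subseteq> A"
  shows "free_extend f F = (\<Sum>k\<in>A. Poly_Mapping.lookup F k *\<^sub>R f k)"
  unfolding free_extend_def using assms
  by (intro sum.mono_neutral_left) (auto simp: in_keys_iff)

lemma linear_free_extend: "linear (free_extend f)"
proof (rule linearI)
  fix F G :: "'a \<Rightarrow>\<^sub>0 real" and r :: real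
  let ?A = "Poly_Mapping.keys F \<union> Poly_Mapping.keys G"
  have "Poly_Mapping.keys (F + G) \<subseteq> ?A" by (rule keys_add)
  then show "free_extend f (F + G) = free_extend f F + free_extend f G"
    by (simp add: free_extend_superset[of ?A] lookup_add scaleR_add_left sum.distrib)
  have "Poly_Mapping.keys (r *\<^sub>R F) \<subseteq> Poly_Mapping.keys F" by (auto simp: in_keys_iff)
  then show "free_extend f (r *\<^sub>R F) = r *\<^sub>R free_extend f F"
    by (simp add: free_extend_superset[of "Poly_Mapping.keys F"] scaleR_sum_right)
qed

lemma free_extend_single [simp]: "free_extend f (Poly_Mapping.single k r) = r *\<^sub>R f k"
  by (cases "r = 0") (simp_all add: free_extend_def)

lemma free_decomp:
  "(F :: 'k \<Rightarrow>\<^sub>0 real) = free_extend (\<lambda>k. Poly_Mapping.single k 1) F"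
proof (rule poly_mapping_eqI)
  fix k
  have "Poly_Mapping.lookup (free_extend (\<lambda>k. Poly_Mapping.single k 1) F) k =
        (\<Sum>j\<in>Poly_Mapping.keys F. if j = k then Poly_Mapping.lookup F k else 0)"
    unfolding free_extend_def lookup_sum
    by (intro sum.cong) (auto simp: lookup_single when_def)
  then show "Poly_Mapping.lookup F k =
      Poly_Mapping.lookup (free_extend (\<lambda>k. Poly_Mapping.single k 1) F) k"
    by (simp add: in_keys_iff)
qed

lemma free_extend_relators:
  assumes f: "bilinear f" and F: "F \<in> span tensor_relators"
  shows "free_extend (\<lambda>(x, y). f x y) F = 0"
proof (rule linear_eq_0_on_span[OF linear_free_extend _ F])
  fix F :: "('a \<times> 'b) \<Rightarrow>\<^sub>0 real"
  assume "F \<in> tensor_relators"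
  then show "free_extend (\<lambda>(x, y). f x y) F = 0"
    unfolding tensor_relators_def
    by (auto simp: linear_diff[OF linear_free_extend] linear_scale[OF linear_free_extend]
        bilinear_ladd[OF f] bilinear_radd[OF f] bilinear_lmul[OF f] bilinear_rmul[OF f])
qed

text \<open>
  The linear map on the tensor product induced by a bilinear map. Without bilinearity of \<open>f\<close> the
  value depends on the chosen representative.
\<close>

definition tensor_lift ::
  "('a::real_vector \<Rightarrow> 'b::real_vector \<Rightarrow> 'c::real_vector) \<Rightarrow> ('a, 'b) tensor \<Rightarrow> 'c" where
  "tensor_lift f t = free_extend (\<lambda>(x, y). f x y) (rep_tensor t)"

lemma tensor_lift_abs:
  assumes "bilinear f"
  shows "tensor_lift f (abs_tensor F) = free_extend (\<lambda>(x, y). f x y) F"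
proof -
  have "tensor_eq (rep_tensor (abs_tensor F)) F"
    by (rule Quotient3_rep_abs[OF Quotient3_tensor]) (simp add: tensor_eq_def span_zero)
  then have "free_extend (\<lambda>(x, y). f x y) (rep_tensor (abs_tensor F) - F) = 0"
    unfolding tensor_eq_def by (rule free_extend_relators[OF assms])
  then show ?thesis
    by (simp add: tensor_lift_def linear_diff[OF linear_free_extend])
qed

lemma linear_tensor_lift:
  assumes "bilinear f"
  shows "linear (tensor_lift f)"
proof (rule linearI)
  fix s t :: "('a, 'b) tensor" and r :: real
  obtain F G where st: "s = abs_tensor F" "t = abs_tensor G"
    by (metis Quotient3_tensor Quotient3_abs_rep)
  show "tensor_lift f (s + t) = tensor_lift f s + tensor_lift f t"
    by (simp add: st plus_tensor.abs_eq tensor_lift_abs[OF assms] linear_add[OF linear_free_extend])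
  show "tensor_lift f (r *\<^sub>R s) = r *\<^sub>R tensor_lift f s"
    by (simp add: st scaleR_tensor.abs_eq tensor_lift_abs[OF assms]
        linear_scale[OF linear_free_extend])
qed

lemma tensor_lift_tens:
  assumes "bilinear f"
  shows "tensor_lift f (tens x y) = f x y"
  by (simp add: tens.abs_eq tensor_lift_abs[OF assms])

lemma linear_abs_tensor: "linear abs_tensor"
  by (rule linearI) (simp_all add: plus_tensor.abs_eq scaleR_tensor.abs_eq)

lemma tensor_span: "t \<in> span (range (\<lambda>(x, y). tens x y))"
proof -
  obtain F where t: "t = abs_tensor F"
    by (metis Quotient3_tensor Quotient3_abs_rep)
  have "t = abs_tensor (free_extend (\<lambda>k. Poly_Mapping.single k 1) F)"
    using t by (simp flip: free_decomp)
  also have "\<dots> = (\<Sum>k\<in>Poly_Mapping.keys F. Poly_Mapping.lookup F k *\<^sub>R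
      (case k of (x, y) \<Rightarrow> tens x y))"
    by (auto simp: free_extend_def linear_sum[OF linear_abs_tensor]
        linear_scale[OF linear_abs_tensor] tens.abs_eq intro!: sum.cong)
  also have "\<dots> \<in> span (range (\<lambda>(x, y). tens x y))"
    by (intro span_sum span_scale span_base) auto
  finally show ?thesis .
qed

lemma tensor_linear_eqI:
  assumes "linear f" "linear g" "\<And>x y. f (tens x y) = g (tens x y)"
  shows "f t = g t"
  by (rule linear_eq_on[OF assms(1,2) tensor_span]) (use assms(3) in auto)

lemma bilinearI':
  assumes "\<And>x x' y. f (x + x') y = f x y + f x' y" "\<And>r x y. f (r *\<^sub>R x) y = r *\<^sub>R f x y"
    and "\<And>x y y'. f x (y + y') = f x y + f x y'" "\<And>r x y. f x (r *\<^sub>R y) = r *\<^sub>R f x y"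
  shows "bilinear f"
  using assms by (auto simp: bilinear_def intro!: linearI)

lemmas tens_simps = bilinear_ladd[OF bilinear_tens] bilinear_radd[OF bilinear_tens]
  bilinear_lmul[OF bilinear_tens] bilinear_rmul[OF bilinear_tens]

lemma bilinear_tens_mult_right:
  "bilinear (\<lambda>x' y'. tens ((x :: 'a::real_algebra) * x') ((y :: 'b::real_algebra) * y'))"
  by (rule bilinearI') (simp_all add: tens_simps algebra_simps)

lemma bilinear_tens_mult_left:
  fixes t :: "('a::real_algebra, 'b::real_algebra) tensor"
  shows "bilinear (\<lambda>x y. tensor_lift (\<lambda>x' y'. tens (x * x') (y * y')) t)"
proof (rule bilinearI')
  fix x x' :: 'a and y y' :: 'b and r :: real
  note l = linear_tensor_lift[OF bilinear_tens_mult_right]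
  note v = tensor_lift_tens[OF bilinear_tens_mult_right]
  show "tensor_lift (\<lambda>x'' y''. tens ((x + x') * x'') (y * y'')) t =
      tensor_lift (\<lambda>x'' y''. tens (x * x'') (y * y'')) t +
      tensor_lift (\<lambda>x'' y''. tens (x' * x'') (y * y'')) t"
    by (rule tensor_linear_eqI[OF l linear_compose_add[OF l l]])
      (simp only: v, simp only: tens_simps distrib_right)
  show "tensor_lift (\<lambda>x'' y''. tens (x * x'') ((y + y') * y'')) t =
      tensor_lift (\<lambda>x'' y''. tens (x * x'') (y * y'')) t +
      tensor_lift (\<lambda>x'' y''. tens (x * x'') (y' * y'')) t"
    by (rule tensor_linear_eqI[OF l linear_compose_add[OF l l]])
      (simp only: v, simp only: tens_simps distrib_right)
  show "tensor_lift (\<lambda>x'' y''. tens (r *\<^sub>R x * x'') (y * y'')) t =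
      r *\<^sub>R tensor_lift (\<lambda>x'' y''. tens (x * x'') (y * y'')) t"
    by (rule tensor_linear_eqI[OF l linear_compose_scale_right[OF l]])
      (simp only: v, simp only: tens_simps mult_scaleR_left)
  show "tensor_lift (\<lambda>x'' y''. tens (x * x'') (r *\<^sub>R y * y'')) t =
      r *\<^sub>R tensor_lift (\<lambda>x'' y''. tens (x * x'') (y * y'')) t"
    by (rule tensor_linear_eqI[OF l linear_compose_scale_right[OF l]])
      (simp only: v, simp only: tens_simps mult_scaleR_left)
qed

instantiation tensor :: (real_algebra, real_algebra) times
begin

definition times_tensor :: "('a, 'b) tensor \<Rightarrow> ('a, 'b) tensor \<Rightarrow> ('a, 'b) tensor" where
  "s * t = tensor_lift (\<lambda>x y. tensor_lift (\<lambda>x' y'. tens (x * x') (y * y')) t) s"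

instance ..

end

lemma tens_mult_tens: "tens x y * tens x' y' = tens (x * x') (y * y')"
  unfolding times_tensor_def
  by (subst tensor_lift_tens[OF bilinear_tens_mult_left])
    (rule tensor_lift_tens[OF bilinear_tens_mult_right])

lemma linear_tensor_mult_left: "linear (\<lambda>s. s * (t :: ('a::real_algebra, 'b::real_algebra) tensor))"
  unfolding times_tensor_def by (rule linear_tensor_lift[OF bilinear_tens_mult_left])

lemma linear_tensor_mult_right: "linear (\<lambda>t. s * (t :: ('a::real_algebra, 'b::real_algebra) tensor))"
proof (rule linearI)
  fix t t' :: "('a, 'b) tensor" and r :: real
  note m = linear_tensor_mult_left
  have *: "linear (\<lambda>t. tens x y * t)" for x :: 'a and y :: 'b
    using linear_tensor_lift[OF bilinear_tens_mult_right]
    by (simp add: times_tensor_def tensor_lift_tens[OF bilinear_tens_mult_left])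
  show "s * (t + t') = s * t + s * t'"
    by (rule tensor_linear_eqI[OF m linear_compose_add[OF m m]]) (simp add: linear_add[OF *])
  show "s * (r *\<^sub>R t) = r *\<^sub>R (s * t)"
    by (rule tensor_linear_eqI[OF m linear_compose_scale_right[OF m]])
      (simp add: linear_scale[OF *])
qed

instance tensor :: (real_algebra, real_algebra) real_algebra
proof
  fix a b c :: "('a, 'b) tensor" and r :: real
  note L = linear_tensor_mult_left and R = linear_tensor_mult_right
  show "(a + b) * c = a * c + b * c" by (rule linear_add[OF L])
  show "a * (b + c) = a * b + a * c" by (rule linear_add[OF R])
  show "(r *\<^sub>R a) * b = r *\<^sub>R (a * b)" by (rule linear_scale[OF L])
  show "a * (r *\<^sub>R b) = r *\<^sub>R (a * b)" by (rule linear_scale[OF R])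
  note LL = linear_compose[OF L L, unfolded o_def] and LR = linear_compose[OF L R, unfolded o_def]
    and RL = linear_compose[OF R L, unfolded o_def] and RR = linear_compose[OF R R, unfolded o_def]
  show "a * b * c = a * (b * c)"
  proof (rule tensor_linear_eqI[OF LL L])
    fix x :: 'a and y :: 'b
    show "tens x y * b * c = tens x y * (b * c)"
    proof (rule tensor_linear_eqI[OF RL LR])
      fix x' :: 'a and y' :: 'b
      show "tens x y * tens x' y' * c = tens x y * (tens x' y' * c)"
        by (rule tensor_linear_eqI[OF R RR]) (simp add: tens_mult_tens mult.assoc)
    qed
  qed
qed

lemma tens_eq_0_iff: "tens x y = 0 \<longleftrightarrow> x = 0 \<or> y = 0"
proof
  assume 0: "tens x y = 0"
  show "x = 0 \<or> y = 0"
  proof (rule ccontr)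
    assume "\<not> (x = 0 \<or> y = 0)"
    then have xy: "independent {x}" "independent {y}" by auto
    obtain f :: "'a \<Rightarrow> real" where f: "linear f" "f x = 1"
      using linear_independent_extend[OF xy(1), of "\<lambda>_. 1 :: real"] by auto
    obtain g :: "'b \<Rightarrow> real" where g: "linear g" "g y = 1"
      using linear_independent_extend[OF xy(2), of "\<lambda>_. 1 :: real"] by auto
    have b: "bilinear (\<lambda>x y. f x * g y)"
      by (rule bilinearI')
        (simp_all add: linear_add[OF f(1)] linear_add[OF g(1)] linear_scale[OF f(1)]
            linear_scale[OF g(1)] algebra_simps)
    have "1 = tensor_lift (\<lambda>x y. f x * g y) (tens x y)"
      by (simp add: tensor_lift_tens[OF b] f g)
    also have "\<dots> = 0" by (simp add: 0 linear_0[OF linear_tensor_lift[OF b]])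
    finally show False by simp
  qed
qed (auto simp: bilinear_lzero[OF bilinear_tens] bilinear_rzero[OF bilinear_tens])

instantiation tensor :: (real_algebra_1, real_algebra_1) real_algebra_1
begin

definition one_tensor :: "('a, 'b) tensor" where "1 = tens 1 1"

instance
proof
  fix a :: "('a, 'b) tensor"
  have i: "linear (\<lambda>a :: ('a, 'b) tensor. a)" by (rule linear_ident)
  show "1 * a = a"
    by (rule tensor_linear_eqI[OF linear_tensor_mult_right i])
      (simp add: one_tensor_def tens_mult_tens)
  show "a * 1 = a"
    by (rule tensor_linear_eqI[OF linear_tensor_mult_left i])
      (simp add: one_tensor_def tens_mult_tens)
  show "(0 :: ('a, 'b) tensor) \<noteq> 1"
    by (metis one_tensor_def tens_eq_0_iff zero_neq_one)
qed

end

text \<open>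
  For subspaces \<open>S\<close> and \<open>T\<close>, the canonical map from the tensor product of \<open>S\<close> and \<open>T\<close> to the
  tensor product of the ambient spaces is injective, since we work over a field. The tensor
  product of \<open>S\<close> and \<open>T\<close> is identified with its image; the lemma \<open>tensor_sub_universal\<close>
  confirms that this image has the universal property.
\<close>

definition tensor_sub ::
  "'a::real_vector set \<Rightarrow> 'b::real_vector set \<Rightarrow> ('a, 'b) tensor set" where
  "tensor_sub S T = span {tens x y | x y. x \<in> S \<and> y \<in> T}"

lemma tensor_sub_universal:
  fixes f :: "'a::real_vector \<Rightarrow> 'b::real_vector \<Rightarrow> 'c::real_vector"
  assumes S: "subspace S" and T: "subspace T"
    and "\<And>x x' y. x \<in> S \<Longrightarrow> x' \<in> S \<Longrightarrow> y \<in> T \<Longrightarrow> f (x + x') y = f x y + f x' y"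
    and "\<And>x y y'. x \<in> S \<Longrightarrow> y \<in> T \<Longrightarrow> y' \<in> T \<Longrightarrow> f x (y + y') = f x y + f x y'"
    and "\<And>r x y. x \<in> S \<Longrightarrow> y \<in> T \<Longrightarrow> f (r *\<^sub>R x) y = r *\<^sub>R f x y"
    and "\<And>r x y. x \<in> S \<Longrightarrow> y \<in> T \<Longrightarrow> f x (r *\<^sub>R y) = r *\<^sub>R f x y"
  obtains h where "linear h" "\<And>x y. x \<in> S \<Longrightarrow> y \<in> T \<Longrightarrow> h (tens x y) = f x y"
    "\<And>h' t. linear h' \<Longrightarrow> (\<And>x y. x \<in> S \<Longrightarrow> y \<in> T \<Longrightarrow> h' (tens x y) = f x y) \<Longrightarrow>
       t \<in> tensor_sub S T \<Longrightarrow> h' t = h t"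
proof -
  obtain p :: "'a \<Rightarrow> 'a" where p: "linear p" "range p \<subseteq> S" "\<And>x. x \<in> S \<Longrightarrow> p x = x"
    using linear_exists_left_inverse_on[OF linear_ident S] by auto
  obtain q :: "'b \<Rightarrow> 'b" where q: "linear q" "range q \<subseteq> T" "\<And>y. y \<in> T \<Longrightarrow> q y = y"
    using linear_exists_left_inverse_on[OF linear_ident T] by auto
  have pq: "p x \<in> S" "q y \<in> T" for x y using p(2) q(2) by auto
  have b: "bilinear (\<lambda>x y. f (p x) (q y))"
    by (rule bilinearI') (simp_all add: linear_add[OF p(1)] linear_add[OF q(1)] linear_scale[OF p(1)]
          linear_scale[OF q(1)] pq assms)
  show ?thesis
  proof (rule that[OF linear_tensor_lift[OF b]])
    show v: "tensor_lift (\<lambda>x y. f (p x) (q y)) (tens x y) = f x y" if "x \<in> S" "y \<in> T" for x y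
      by (simp add: tensor_lift_tens[OF b] p q that)
    show "h' t = tensor_lift (\<lambda>x y. f (p x) (q y)) t"
      if "linear h'" "\<And>x y. x \<in> S \<Longrightarrow> y \<in> T \<Longrightarrow> h' (tens x y) = f x y"
        "t \<in> tensor_sub S T" for h' t
      by (rule linear_eq_on[OF that(1) linear_tensor_lift[OF b] that(3)[unfolded tensor_sub_def]])
        (auto simp: v that(2))
  qed
qed

section \<open>Graded algebras\<close>

text \<open>
  Algebras are subalgebras \<open>S\<close> of an ambient type of real algebras. The grading group is abelian and
  written additively, so the neutral component of \<open>\<Gamma>\<close> is \<open>\<Gamma> 0\<close>.
\<close>

definition subalgebra :: "'a::real_algebra set \<Rightarrow> bool" where
  "subalgebra S \<longleftrightarrow> subspace S \<and> (\<forall>x\<in>S. \<forall>y\<in>S. x * y \<in> S)"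

definition finite_dimensional :: "'a::real_vector set \<Rightarrow> bool" where
  "finite_dimensional S \<longleftrightarrow> (\<exists>B. finite B \<and> span B = S)"

definition two_sided_ideal :: "'a::real_algebra set \<Rightarrow> 'a set \<Rightarrow> bool" where
  "two_sided_ideal S I \<longleftrightarrow>
     subspace I \<and> I \<subseteq> S \<and> (\<forall>a\<in>S. \<forall>x\<in>I. a * x \<in> I \<and> x * a \<in> I)"

definition simple_algebra :: "'a::real_algebra set \<Rightarrow> bool" where
  "simple_algebra S \<longleftrightarrow>
     subalgebra S \<and> (\<exists>x\<in>S. \<exists>y\<in>S. x * y \<noteq> 0) \<and> (\<forall>I. two_sided_ideal S I \<longrightarrow> I = {0} \<or> I = S)"

definition centralizer :: "'a::real_algebra set \<Rightarrow> 'a set" where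
  "centralizer X = {a. \<forall>x\<in>X. a * x = x * a}"

definition direct_sum_decomposition ::
  "'a::real_vector set \<Rightarrow> ('g \<Rightarrow> 'a set) \<Rightarrow> bool" where
  "direct_sum_decomposition S \<Gamma> \<longleftrightarrow>
     (\<forall>g. subspace (\<Gamma> g) \<and> \<Gamma> g \<subseteq> S) \<and>
     (\<forall>x\<in>S. \<exists>!c. finite {g. c g \<noteq> 0} \<and> (\<forall>g. c g \<in> \<Gamma> g) \<and> x = (\<Sum>g | c g \<noteq> 0. c g))"

definition grading :: "'a::real_algebra set \<Rightarrow> ('g::ab_group_add \<Rightarrow> 'a set) \<Rightarrow> bool" where
  "grading S \<Gamma> \<longleftrightarrow>
     subalgebra S \<and> direct_sum_decomposition S \<Gamma> \<and>
     (\<forall>g h. \<forall>x\<in>\<Gamma> g. \<forall>y\<in>\<Gamma> h. x * y \<in> \<Gamma> (g + h))"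

definition division_grading ::
  "'a::real_algebra_1 set \<Rightarrow> ('g::ab_group_add \<Rightarrow> 'a set) \<Rightarrow> bool" where
  "division_grading S \<Gamma> \<longleftrightarrow>
     grading S \<Gamma> \<and> 1 \<in> S \<and> (\<forall>g. \<forall>x\<in>\<Gamma> g. x \<noteq> 0 \<longrightarrow> (\<exists>y\<in>S. x * y = 1 \<and> y * x = 1))"

definition components_of_dim :: "('g \<Rightarrow> 'a::real_vector set) \<Rightarrow> nat \<Rightarrow> bool" where
  "components_of_dim \<Gamma> d \<longleftrightarrow> (\<forall>g. \<Gamma> g \<noteq> {0} \<longrightarrow> dim (\<Gamma> g) = d)"

definition induced_grading :: "('g \<Rightarrow> 'a set) \<Rightarrow> 'a set \<Rightarrow> 'g \<Rightarrow> 'a set" where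
  "induced_grading \<Gamma> F = (\<lambda>g. \<Gamma> g \<inter> F)"

definition graded_subalgebra ::
  "'a::real_algebra set \<Rightarrow> ('g::ab_group_add \<Rightarrow> 'a set) \<Rightarrow> 'a set \<Rightarrow> bool" where
  "graded_subalgebra S \<Gamma> F \<longleftrightarrow>
     subalgebra F \<and> F \<subseteq> S \<and> direct_sum_decomposition F (induced_grading \<Gamma> F)"

definition product_grading ::
  "('g \<Rightarrow> 'a::real_vector set) \<Rightarrow> ('h \<Rightarrow> 'b::real_vector set) \<Rightarrow>
   'g \<times> 'h \<Rightarrow> ('a, 'b) tensor set" where
  "product_grading \<Gamma> \<Delta> = (\<lambda>(g, h). tensor_sub (\<Gamma> g) (\<Delta> h))"

text \<open>The type \<open>num1\<close>, whose only element is \<open>0\<close>, serves as the trivial group.\<close>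

definition trivial_grading :: "'a set \<Rightarrow> num1 \<Rightarrow> 'a set" where
  "trivial_grading S = (\<lambda>_. S)"

definition algebra_iso ::
  "'a::real_algebra set \<Rightarrow> 'b::real_algebra set \<Rightarrow> ('a \<Rightarrow> 'b) \<Rightarrow> bool" where
  "algebra_iso S T \<phi> \<longleftrightarrow>
     bij_betw \<phi> S T \<and>
     (\<forall>x\<in>S. \<forall>y\<in>S. \<phi> (x + y) = \<phi> x + \<phi> y \<and> \<phi> (x * y) = \<phi> x * \<phi> y) \<and>
     (\<forall>r. \<forall>x\<in>S. \<phi> (r *\<^sub>R x) = r *\<^sub>R \<phi> x)"

definition graded_algebra_iso ::
  "'a::real_algebra set \<Rightarrow> ('g::ab_group_add \<Rightarrow> 'a set) \<Rightarrow>
   'b::real_algebra set \<Rightarrow> ('g \<Rightarrow> 'b set) \<Rightarrow> ('a \<Rightarrow> 'b) \<Rightarrow> bool" where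
  "graded_algebra_iso S \<Gamma> T \<Delta> \<phi> \<longleftrightarrow>
     grading S \<Gamma> \<and> grading T \<Delta> \<and> algebra_iso S T \<phi> \<and> (\<forall>g. \<phi> ` \<Gamma> g = \<Delta> g)"

end

theory Submission
  imports Defs "HOL-Computational_Algebra.Fundamental_Theorem_Algebra"
begin

text \<open>
  The neutral component is a four-dimensional real division algebra, hence by Frobenius it is
  \<open>\<real>1 + \<real>i + \<real>j + \<real>ij\<close> with anticommuting square roots \<open>i\<close>, \<open>j\<close> of \<open>- 1\<close>. Averaging over the
  conjugations by \<open>1\<close>, \<open>i\<close>, \<open>j\<close>, \<open>ij\<close> gives a projection \<open>proj\<close> of the whole algebra onto the
  centralizer that preserves homogeneous components, and every \<open>c\<close> satisfies
  \<open>c = proj c - i proj (i c) - j proj (j c) - ij proj (ij c)\<close>. Reading the four summands as pure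
  tensors inverts the multiplication map; no appeal to the Skolem--Noether theorem is needed.
  A homogeneous component of the centralizer is a multiple of any of its nonzero elements, because
  the centre of the quaternions is \<open>\<real>\<close>.
\<close>

section \<open>Quadratic elements of division algebras\<close>

text \<open>Horner's rule with real coefficients and an argument in a possibly noncommutative
  algebra. Real scalars are central, so evaluation at a fixed element is still multiplicative in the
  polynomial.\<close>

definition eval_poly :: "real poly \<Rightarrow> 'a::real_algebra_1 \<Rightarrow> 'a" where
  "eval_poly p a = fold_coeffs (\<lambda>c v. c *\<^sub>R 1 + a * v) p 0"

lemma eval_poly_0 [simp]: "eval_poly 0 a = 0"
  by (simp add: eval_poly_def)

lemma eval_poly_pCons [simp]: "eval_poly (pCons c p) a = c *\<^sub>R 1 + a * eval_poly p a"
  by (cases "p = 0 \<and> c = 0") (auto simp: eval_poly_def fold_coeffs_pCons_eq)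

lemma eval_poly_add: "eval_poly (p + q) a = eval_poly p a + eval_poly q a"
  by (induction p q rule: poly_induct2) (simp_all add: algebra_simps)

lemma eval_poly_smult: "eval_poly (smult c p) a = c *\<^sub>R eval_poly p a"
  by (induction p) (simp_all add: algebra_simps)

lemma eval_poly_mult: "eval_poly (p * q) a = eval_poly p a * eval_poly q a"
  by (induction p) (simp_all add: eval_poly_add eval_poly_smult algebra_simps)

lemma eval_poly_monom: "eval_poly (monom c n) a = c *\<^sub>R a ^ n"
  by (induction n) (simp_all add: monom_Suc monom_0)

lemma eval_poly_sum: "eval_poly (\<Sum>k\<in>K. f k) a = (\<Sum>k\<in>K. eval_poly (f k) a)"
  by (induction K rule: infinite_finite_induct) (simp_all add: eval_poly_add)

lemma eval_poly_mem:
  assumes "subalgebra A" "1 \<in> A" "a \<in> A"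
  shows "eval_poly p a \<in> A"
  using assms
  by (induction p) (auto simp: subalgebra_def intro!: subspace_add subspace_scale subspace_0)

text \<open>Bridge to the fundamental theorem of algebra: the complex numbers are themselves a real
  algebra, so a complex root of \<open>p\<close> is again a zero of
  \<open>eval_poly p\<close>.\<close>

lemma poly_map_poly_of_real: "poly (map_poly complex_of_real p) z = eval_poly p z"
  by (induction p) (simp_all add: map_poly_pCons scaleR_conv_of_real)

text \<open>In finite dimension the infinitely many powers of \<open>a\<close> cannot be linearly
  independent; a dependence between them is a polynomial vanishing at \<open>a\<close>.\<close>

lemma annihilating_poly:
  fixes a :: "'a::real_algebra_1"
  assumes "finite_dimensional (UNIV :: 'a set)"
  obtains p where "p \<noteq> 0" "eval_poly p a = 0"
proof (cases "inj (\<lambda>n::nat. a ^ n)")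
  \<comment> \<open>\<open>dependent\<close> speaks about sets, where equal powers collapse to one
    vector. A repetition among the powers is therefore treated separately; it gives X^m -
    X^n.\<close>
  case False
  then obtain m n :: nat where mn: "m \<noteq> n" "a ^ m = a ^ n" by (auto simp: inj_def)
  show ?thesis
  proof (rule that)
    have "coeff (monom 1 m + monom (-1) n :: real poly) m \<noteq> 0" using mn by simp
    then show "monom 1 m + monom (-1) n \<noteq> (0 :: real poly)" by force
    show "eval_poly (monom 1 m + monom (-1) n) a = 0"
      using mn by (simp add: eval_poly_add eval_poly_monom)
  qed
next
  case True
  let ?f = "\<lambda>n::nat. a ^ n"
  obtain B where B: "finite B" "span B = (UNIV :: 'a set)"
    using assms by (auto simp: finite_dimensional_def)
  have "infinite (range ?f)" using True range_inj_infinite by blast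
  then have "dependent (range ?f)" using independent_span_bound[OF B(1), of "range ?f"] B(2) by auto
  then obtain t u where tu: "finite t \<and> t \<subseteq> range ?f \<and> (\<Sum>v\<in>t. u v *\<^sub>R v) = 0 \<and> (\<exists>v\<in>t. u v \<noteq> 0)"
    unfolding dependent_explicit by (elim exE) (rule that)
  note t = tu[THEN conjunct1] tu[THEN conjunct2, THEN conjunct1]
    tu[THEN conjunct2, THEN conjunct2, THEN conjunct1]
  obtain w where w: "w \<in> t" "u w \<noteq> 0"
    by (rule bexE[OF tu[THEN conjunct2, THEN conjunct2, THEN conjunct2]]) (rule that)
  have f_inv: "?f (inv ?f v) = v" if "v \<in> t" for v
    by (rule f_inv_into_f) (rule subsetD[OF t(2) that])
  \<comment> \<open>\<open>inv ?f v\<close> recovers the exponent of the power \<open>v\<close>,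
    which turns the linear relation into a polynomial. Distinct powers have distinct exponents, so
    no coefficients merge.\<close>
  let ?p = "\<Sum>v\<in>t. monom (u v) (inv ?f v)"
  show ?thesis
  proof (rule that)
    have "inv ?f v = inv ?f w \<longleftrightarrow> v = w" if "v \<in> t" for v
      using f_inv[OF that] f_inv[OF w(1)] by metis
    then have "coeff ?p (inv ?f w) = (\<Sum>v\<in>t. if v = w then u v else 0)"
      by (auto simp: coeff_sum coeff_monom intro!: sum.cong)
    also have "\<dots> = u w" using t(1) w(1) by simp
    finally show "?p \<noteq> 0" using w(2) by force
    show "eval_poly ?p a = 0"
      using t(3) f_inv by (simp add: eval_poly_sum eval_poly_monom)
  qed
qed

text \<open>Induction on the degree: the real minimal polynomial \<open>m\<close> of a complex root
  of \<open>p\<close> divides \<open>p\<close>, and without zero divisors \<open>a\<close> is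
  annihilated by \<open>m\<close> or by the cofactor, which has smaller degree.\<close>

lemma eval_poly_real_or_quadratic:
  fixes a :: "'a::real_algebra_1"
  assumes A: "subalgebra A" "1 \<in> A" "a \<in> A"
    and nzd: "\<forall>x\<in>A. \<forall>y\<in>A. x * y = 0 \<longrightarrow> x = 0 \<or> y = 0"
    and "p \<noteq> 0" "eval_poly p a = 0"
  shows "\<exists>s r. a = s *\<^sub>R 1 \<or> (r \<noteq> 0 \<and> eval_poly [:s\<^sup>2 + r\<^sup>2, - 2 * s, 1:] a = 0)"
  using \<open>p \<noteq> 0\<close> \<open>eval_poly p a = 0\<close>
proof (induction "degree p" arbitrary: p rule: less_induct)
  case less
  have "degree p \<noteq> 0"
  proof
    assume "degree p = 0"
    then obtain c where "p = [:c:]" by (rule degree_eq_zeroE)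
    then show False using less.prems by simp
  qed
  let ?c = "map_poly complex_of_real"
  have "degree (?c p) \<noteq> 0"
    using \<open>degree p \<noteq> 0\<close> by (simp add: degree_map_poly)
  then obtain z :: complex where z: "eval_poly p z = 0"
    using fundamental_theorem_of_algebra[of "?c p"] constant_degree[of "?c p"]
    by (auto simp: poly_map_poly_of_real)
  define s r where "s = Re z" and "r = Im z"
  \<comment> \<open>The minimal polynomial over the reals of z = s + ir: X - s if z is real, and (X
    - s)^2 + r^2 otherwise.\<close>
  define m where "m = (if r = 0 then [:- s, 1:] else [:s\<^sup>2 + r\<^sup>2, - 2 * s, 1:])"
  have m: "m \<noteq> 0" "degree m \<noteq> 0" by (auto simp: m_def)
  have "eval_poly m z = 0"
    by (auto simp: m_def complex_eq_iff s_def r_def power2_eq_square algebra_simps)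
  moreover have "p = (p div m) * m + p mod m" by simp
  ultimately have rz: "eval_poly (p mod m) z = 0"
    using z by (metis add_0 eval_poly_add eval_poly_mult mult_zero_right)
  \<comment> \<open>The remainder vanishes at z and has smaller degree than \<open>m\<close>. A
    nonzero constant has no root, and c + dz = 0 with z not real forces d = 0 and then c =
    0.\<close>
  have "p mod m = 0"
  proof (cases "r = 0")
    case True
    then have "degree (p mod m) = 0"
      using degree_mod_less[OF m(1), of p] by (auto simp: m_def)
    then obtain c where "p mod m = [:c:]" by (rule degree_eq_zeroE)
    then show ?thesis using rz by (simp add: complex_eq_iff)
  next
    case False
    then have "degree (p mod m) < 2"
      using degree_mod_less[OF m(1), of p] by (auto simp: m_def)
    then obtain c d where cd: "p mod m = [:c, d:]"
      by (metis degree_eq_zeroE degree_pCons_eq_if less_2_cases_iff nat.inject One_nat_def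
          pCons_cases zero_neq_one pCons_0_0)
    show ?thesis
      using rz False by (auto simp: cd complex_eq_iff s_def r_def)
  qed
  then have "m dvd p" by (simp add: dvd_eq_mod_eq_0)
  then obtain q where q: "p = m * q" by (elim dvdE)
  have "eval_poly m a * eval_poly q a = 0" using less.prems q by (simp add: eval_poly_mult)
  then consider "eval_poly m a = 0" | "eval_poly q a = 0"
    using nzd eval_poly_mem[OF A] by blast
  then show ?case
  proof cases
    case 1
    then show ?thesis
      by (cases "r = 0") (auto simp: m_def)
  next
    case 2
    have "q \<noteq> 0" "degree q < degree p" using less.prems q m by (auto simp: degree_mult_eq)
    then show ?thesis using less.hyps 2 by blast
  qed
qed

text \<open>Completing the square in the quadratic relation gives (a - s)^2 = -r^2; dividing a - s
  by r yields the square root of -1.\<close>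

lemma real_or_imaginary_unit:
  fixes a :: "'a::real_algebra_1"
  assumes "finite_dimensional (UNIV :: 'a set)"
    and A: "subalgebra A" "1 \<in> A" "a \<in> A"
    and nzd: "\<forall>x\<in>A. \<forall>y\<in>A. x * y = 0 \<longrightarrow> x = 0 \<or> y = 0"
  obtains s where "a = s *\<^sub>R 1"
  | s r u where "r \<noteq> 0" "a = s *\<^sub>R 1 + r *\<^sub>R u" "u \<in> A" "u * u = - 1"
proof -
  obtain p where p: "p \<noteq> 0" "eval_poly p a = 0" by (rule annihilating_poly[OF assms(1)])
  obtain s r where sr: "a = s *\<^sub>R 1 \<or> (r \<noteq> 0 \<and> eval_poly [:s\<^sup>2 + r\<^sup>2, - 2 * s, 1:] a = 0)"
    using eval_poly_real_or_quadratic[OF A nzd p] by blast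
  show ?thesis
  proof (cases "a = s *\<^sub>R 1")
    case True
    then show ?thesis by (rule that(1))
  next
    case False
    then have r: "r \<noteq> 0" and q: "eval_poly [:s\<^sup>2 + r\<^sup>2, - 2 * s, 1:] a = 0" using sr by auto
    let ?u = "(1 / r) *\<^sub>R (a - s *\<^sub>R 1)"
    have "(a - s *\<^sub>R 1) * (a - s *\<^sub>R 1) = eval_poly [:s\<^sup>2 + r\<^sup>2, - 2 * s, 1:] a - r\<^sup>2 *\<^sub>R 1"
      by (simp add: algebra_simps power2_eq_square) (simp flip: scaleR_add_left)
    then have "?u * ?u = - 1" using r q by (simp add: power2_eq_square)
    moreover have "?u \<in> A"
      using A by (auto simp: subalgebra_def intro!: subspace_scale subspace_diff)
    ultimately show ?thesis using that(2)[of r s ?u] r by simp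
  qed
qed

section \<open>Quaternion units\<close>

locale quaternion_units =
  fixes i j :: "'a::real_algebra_1"
  assumes ii: "i * i = - 1" and jj: "j * j = - 1" and ji: "j * i = - (i * j)"
begin

text \<open>Versions of the relations for right-nested words. Together with associativity they move
  \<open>j\<close> behind \<open>i\<close> and delete squares anywhere in a product.\<close>

lemma cancel: "i * (i * x) = - x" "j * (j * x) = - x" "j * (i * x) = - (i * (j * x))"
  by (simp_all add: ii jj ji flip: mult.assoc)

lemmas unit_simps = ii jj ji cancel mult.assoc

text \<open>The average of u c u^{-1} over u = 1, i, j, ij. The minus signs arise because each of i,
  j, ij squares to -1 and so has its negative as inverse.\<close>

definition proj :: "'a \<Rightarrow> 'a" where
  "proj c = (1 / 4) *\<^sub>R (c - i * c * i - j * c * j - i * j * c * (i * j))"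

lemma proj_add: "proj (c + d) = proj c + proj d"
  by (simp add: proj_def algebra_simps)

lemma proj_scaleR: "proj (r *\<^sub>R c) = r *\<^sub>R proj c"
  by (simp add: proj_def algebra_simps)

text \<open>Conjugation by \<open>i\<close> or by \<open>j\<close> only permutes the four averaged
  terms.\<close>

lemma proj_commutes: "proj c * i = i * proj c" "proj c * j = j * proj c"
  by (simp_all add: proj_def unit_simps algebra_simps)

lemma scaleR_4: "4 *\<^sub>R c = c + c + c + (c :: 'a)"
  using scaleR_add_left[of 2 2 c] by (simp add: scaleR_2)

text \<open>The left side is the sum of u^{-1} proj (u c) over u = 1, i, j, ij. Expanding
  \<open>proj\<close>, the term with v c v^{-1} becomes (1/4) (sum over u of u^{-1} v u) c v^{-1}.
  Here u^{-1} v u is v or -v, each sign twice unless v = 1, so only c survives.\<close>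

lemma proj_expand:
  "proj c - i * proj (i * c) - j * proj (j * c) - i * j * proj (i * j * c) = c"
proof -
  have "4 *\<^sub>R (proj c - i * proj (i * c) - j * proj (j * c) - i * j * proj (i * j * c)) = 4 *\<^sub>R c"
    by (simp add: proj_def scaleR_diff_right unit_simps algebra_simps)
      (simp add: scaleR_4 algebra_simps)
  then show ?thesis by simp
qed

text \<open>For \<open>y\<close> commuting with the units, only the unit in front is averaged: 1 is
  fixed, while each of i, j, ij is fixed by two of the conjugations and negated by the other
  two.\<close>

lemma proj_commuting:
  assumes "y * i = i * y" "y * j = j * y"
  shows "proj y = y" "proj (i * y) = 0" "proj (j * y) = 0" "proj (i * (j * y)) = 0"
proof -
  have [simp]: "y * (i * x) = i * (y * x)" "y * (j * x) = j * (y * x)" for x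
    using assms by (metis mult.assoc)+
  show "proj y = y" "proj (i * y) = 0" "proj (j * y) = 0" "proj (i * (j * y)) = 0"
    by (simp_all add: proj_def unit_simps assms flip: scaleR_4)
qed

end

text \<open>The noncommutative case of Frobenius' theorem; dimension above 2 excludes the reals and
  the complex numbers. Some \<open>i\<close> squares to -1, some nonzero \<open>u\<close>
  anticommutes with it, and a multiple of \<open>u\<close> is \<open>j\<close>.\<close>

lemma quaternion_units_exist:
  fixes A :: "'a::real_algebra_1 set"
  assumes fd: "finite_dimensional (UNIV :: 'a set)"
    and A: "subalgebra A" "1 \<in> A"
    and nzd: "\<forall>x\<in>A. \<forall>y\<in>A. x * y = 0 \<longrightarrow> x = 0 \<or> y = 0"
    and dim: "dim A > 2"
  obtains i j where "quaternion_units i j" "i \<in> A" "j \<in> A"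
    "\<And>a. a \<in> A \<Longrightarrow> \<exists>\<alpha> \<beta> \<gamma> \<delta>. a = \<alpha> *\<^sub>R 1 + \<beta> *\<^sub>R i + \<gamma> *\<^sub>R j + \<delta> *\<^sub>R (i * j)"
proof -
  have sub: "subspace A" and mem_mult: "\<And>x y. x \<in> A \<Longrightarrow> y \<in> A \<Longrightarrow> x * y \<in> A"
    using A by (auto simp: subalgebra_def)
  note mem = mem_mult subspace_add[OF sub] subspace_diff[OF sub] subspace_scale[OF sub]
    subspace_neg[OF sub] A(2)
  \<comment> \<open>The dimension bound is used in this form twice: with \<open>b = 1\<close> to
    find a nonreal element, and with \<open>b = i\<close> to find one outside the copy of the
    complex numbers.\<close>
  have not_sub: "\<not> A \<subseteq> span {1, b}" for b
  proof
    assume "A \<subseteq> span {1, b}"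
    then have "dim A \<le> card {1, b}" by (rule dim_le_card) simp
    also have "\<dots> \<le> 2" by (simp add: card_insert_if)
    finally show False using dim by simp
  qed
  obtain a where a: "a \<in> A" "a \<notin> span {1, 1}" using not_sub[of 1] by blast
  obtain i where i: "i \<in> A" "i * i = - 1"
  proof (rule real_or_imaginary_unit[OF fd A a(1) nzd])
    show thesis if "a = s *\<^sub>R 1" for s
      using a(2) that by (auto simp: span_base span_scale)
  qed auto
  have ic: "i * (i * x) = - x" for x by (simp add: i flip: mult.assoc)
  have i0: "i \<noteq> 0" using i by auto
  \<comment> \<open>The commutant of \<open>i\<close> is spanned by 1 and \<open>i\<close>: an
    imaginary unit \<open>u\<close> commuting with \<open>i\<close> satisfies (u - i)(u + i) = u^2 -
    i^2 = 0.\<close>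
  have comm: "\<exists>\<alpha> \<beta>. x = \<alpha> *\<^sub>R 1 + \<beta> *\<^sub>R i" if x: "x \<in> A" "x * i = i * x" for x
    using real_or_imaginary_unit[OF fd A x(1) nzd]
  proof cases
    case (1 s)
    then have "x = s *\<^sub>R 1 + 0 *\<^sub>R i" by simp
    then show ?thesis by blast
  next
    case (2 s r u)
    have "r *\<^sub>R (u * i) = r *\<^sub>R (i * u)" using x(2) unfolding 2(2) by (simp add: algebra_simps)
    then have "(u - i) * (u + i) = 0" using 2(1,4) i by (simp add: algebra_simps)
    then have "u = i \<or> u = - i" using nzd[rule_format, of "u - i" "u + i"] mem 2(3) i
      by (auto simp: eq_neg_iff_add_eq_0)
    then have "x = s *\<^sub>R 1 + r *\<^sub>R i \<or> x = s *\<^sub>R 1 + (- r) *\<^sub>R i" using 2(2) by auto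
    then show ?thesis by blast
  qed
  obtain b where b: "b \<in> A" "b \<notin> span {1, i}" using not_sub[of i] by blast
  \<comment> \<open>twice the part of \<open>b\<close> that anticommutes with \<open>i\<close>\<close>
  define u where "u = b + i * b * i"
  have uA: "u \<in> A" using b i mem by (simp add: u_def)
  have ui: "u * i = - (i * u)" by (simp add: u_def algebra_simps i ic)
  have u0: "u \<noteq> 0"
  proof
    assume "u = 0"
    then have "i * u = 0" by simp
    then have "b * i = i * b" by (simp add: u_def algebra_simps ic)
    then obtain \<alpha> \<beta> where "b = \<alpha> *\<^sub>R 1 + \<beta> *\<^sub>R i" using comm b by blast
    then show False using b(2) by (metis insertCI span_add span_base span_scale)
  qed
  \<comment> \<open>Passing \<open>i\<close> across two factors \<open>u\<close> changes the sign
    twice, so u^2 lies in the commutant of \<open>i\<close>.\<close>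
  have "u * u * i = - (u * (i * u))" by (simp add: ui mult.assoc)
  also have "u * (i * u) = - (i * (u * u))" by (simp add: ui flip: mult.assoc)
  finally have "u * u * i = i * (u * u)" by simp
  then obtain \<alpha> \<beta> where uu: "u * u = \<alpha> *\<^sub>R 1 + \<beta> *\<^sub>R i"
    using comm[of "u * u"] uA mem by blast
  \<comment> \<open>u commutes with u^2 = \<alpha> + \<beta> i but anticommutes with i, which forces
    \<beta> = 0.\<close>
  have "u * (u * u) = (u * u) * u" by (simp add: mult.assoc)
  then have "\<beta> *\<^sub>R (i * u) + \<beta> *\<^sub>R (i * u) = 0" unfolding uu by (simp add: algebra_simps ui)
  then have "(2 * \<beta>) *\<^sub>R (i * u) = 0" by (simp flip: scaleR_add_left)
  moreover have iu0: "i * u \<noteq> 0" using nzd[rule_format, of i u] i uA i0 u0 by auto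
  ultimately have \<beta>: "\<beta> = 0" by simp
  \<comment> \<open>If \<alpha> were nonnegative, u^2 - \<alpha> would split into real linear
    factors, making u real. It would then both commute and anticommute with i.\<close>
  have \<alpha>: "\<alpha> < 0"
  proof (rule ccontr)
    assume "\<not> \<alpha> < 0"
    then have "(u - sqrt \<alpha> *\<^sub>R 1) * (u + sqrt \<alpha> *\<^sub>R 1) = 0"
      using uu \<beta> by (simp add: algebra_simps)
    then have "u = sqrt \<alpha> *\<^sub>R 1 \<or> u = - (sqrt \<alpha> *\<^sub>R 1)"
      using nzd[rule_format, of "u - sqrt \<alpha> *\<^sub>R 1" "u + sqrt \<alpha> *\<^sub>R 1"] mem uA by (auto simp: eq_neg_iff_add_eq_0)
    then have "u * i = i * u" by auto
    then have "2 *\<^sub>R (i * u) = 0" using ui by (metis add.right_inverse scaleR_2)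
    then show False using iu0 by simp
  qed
  define j where "j = (1 / sqrt (- \<alpha>)) *\<^sub>R u"
  have j: "j \<in> A" "j * j = - 1" "j * i = - (i * j)"
    using uA mem \<alpha> by (simp_all add: j_def uu \<beta> ui)
  have jc: "j * (j * x) = - x" "j * (i * x) = - (i * (j * x))" for x
    by (simp_all add: j flip: mult.assoc)
  show ?thesis
  proof
    show "quaternion_units i j" using i j by (simp add: quaternion_units_def)
    show "i \<in> A" "j \<in> A" by fact+
    fix a assume a: "a \<in> A"
    \<comment> \<open>The parts of \<open>a\<close> that commute and anticommute with
      \<open>i\<close>. The first is covered by \<open>comm\<close>, the second after a
      multiplication by \<open>j\<close>.\<close>
    define v w where "v = (1 / 2) *\<^sub>R (a - i * a * i)" and "w = (1 / 2) *\<^sub>R (a + i * a * i)"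
    have vw: "v \<in> A" "w \<in> A" using a i mem by (simp_all add: v_def w_def)
    have "v * i = i * v" by (simp add: v_def algebra_simps i ic)
    then obtain \<alpha> \<beta> where v: "v = \<alpha> *\<^sub>R 1 + \<beta> *\<^sub>R i" using comm vw by blast
    have wi: "w * i = - (i * w)" by (simp add: w_def algebra_simps i ic)
    \<comment> \<open>Both \<open>w\<close> and \<open>j\<close> anticommute with \<open>i\<close>,
      so their product commutes with it. Multiplying by -j afterwards recovers \<open>w\<close>,
      since j^2 = -1.\<close>
    have "w * j * i = i * (w * j)"
      by (simp add: mult.assoc j) (simp add: wi flip: mult.assoc)
    then obtain \<gamma> \<delta> where w: "w * j = \<gamma> *\<^sub>R 1 + \<delta> *\<^sub>R i" using comm[of "w * j"] vw j mem by blast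
    have "w = - (w * j) * j" by (simp add: j mult.assoc)
    also have "\<dots> = (- \<gamma>) *\<^sub>R j + (- \<delta>) *\<^sub>R (i * j)" unfolding w by (simp add: algebra_simps)
    finally have w': "w = (- \<gamma>) *\<^sub>R j + (- \<delta>) *\<^sub>R (i * j)" .
    have "a = v + w" by (simp add: v_def w_def flip: scaleR_add_right scaleR_2)
    then have "a = \<alpha> *\<^sub>R 1 + \<beta> *\<^sub>R i + (- \<gamma>) *\<^sub>R j + (- \<delta>) *\<^sub>R (i * j)"
      unfolding v w' by (simp add: add.assoc)
    then show "\<exists>\<alpha> \<beta> \<gamma> \<delta>. a = \<alpha> *\<^sub>R 1 + \<beta> *\<^sub>R i + \<gamma> *\<^sub>R j + \<delta> *\<^sub>R (i * j)" by blast
  qed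
qed

section \<open>Homogeneous components\<close>

text \<open>Meaningful only for \<open>x\<close> in the sum of the \<open>\<Gamma> g\<close>, when this sum is direct.\<close>

definition component :: "('g \<Rightarrow> 'a::real_vector set) \<Rightarrow> 'a \<Rightarrow> 'g \<Rightarrow> 'a" where
  "component \<Gamma> x =
     (THE c. finite {g. c g \<noteq> 0} \<and> (\<forall>g. c g \<in> \<Gamma> g) \<and> x = (\<Sum>g | c g \<noteq> 0. c g))"

lemma component:
  assumes "direct_sum_decomposition S \<Gamma>" "x \<in> S"
  shows "finite {g. component \<Gamma> x g \<noteq> 0}" "component \<Gamma> x g \<in> \<Gamma> g"
    "x = (\<Sum>g | component \<Gamma> x g \<noteq> 0. component \<Gamma> x g)"
proof -
  have "\<exists>!c. finite {g. c g \<noteq> 0} \<and> (\<forall>g. c g \<in> \<Gamma> g) \<and> x = (\<Sum>g | c g \<noteq> 0. c g)"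
    using assms unfolding direct_sum_decomposition_def by (elim conjE) (rule bspec)
  note * = theI'[OF this, folded component_def]
  show "finite {g. component \<Gamma> x g \<noteq> 0}" by (rule *[THEN conjunct1])
  show "component \<Gamma> x g \<in> \<Gamma> g" by (rule spec[OF *[THEN conjunct2, THEN conjunct1]])
  show "x = (\<Sum>g | component \<Gamma> x g \<noteq> 0. component \<Gamma> x g)"
    by (rule *[THEN conjunct2, THEN conjunct2])
qed

lemma sum_support:
  assumes "finite K" "\<And>g. c g \<noteq> 0 \<Longrightarrow> g \<in> K"
  shows "(\<Sum>g | c g \<noteq> 0. c g) = sum c K"
  using assms by (intro sum.mono_neutral_left) auto

text \<open>The sum may run over any finite \<open>K\<close> containing the support, so the exact
  support of a candidate family need not be known.\<close>

lemma component_unique: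
  assumes D: "direct_sum_decomposition S \<Gamma>" and x: "x \<in> S"
    and K: "finite K" "\<And>g. c g \<noteq> 0 \<Longrightarrow> g \<in> K"
    and c: "\<And>g. c g \<in> \<Gamma> g" "x = sum c K"
  shows "component \<Gamma> x = c"
proof -
  have "\<exists>!c. finite {g. c g \<noteq> 0} \<and> (\<forall>g. c g \<in> \<Gamma> g) \<and> x = (\<Sum>g | c g \<noteq> 0. c g)"
    using D x unfolding direct_sum_decomposition_def by (elim conjE) (rule bspec)
  moreover have "finite {g. c g \<noteq> 0} \<and> (\<forall>g. c g \<in> \<Gamma> g) \<and> x = (\<Sum>g | c g \<noteq> 0. c g)"
  proof (intro conjI allI)
    show "finite {g. c g \<noteq> 0}" by (rule finite_subset[OF _ K(1)]) (use K(2) in auto)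
    show "c g \<in> \<Gamma> g" for g by (rule c)
    show "x = (\<Sum>g | c g \<noteq> 0. c g)" unfolding c(2) by (rule sum_support[OF K, symmetric])
  qed
  ultimately show ?thesis
    unfolding component_def
    by (rule the1_equality[where P = "\<lambda>c. finite {g. c g \<noteq> 0} \<and> (\<forall>g. c g \<in> \<Gamma> g) \<and>
          x = (\<Sum>g | c g \<noteq> 0. c g)"])
qed

lemma direct_sum_decompositionI:
  assumes sub: "\<And>g. subspace (\<Gamma> g)" "\<And>g. \<Gamma> g \<subseteq> S"
    and ex: "\<And>x. x \<in> S \<Longrightarrow>
      \<exists>c. finite {g. c g \<noteq> 0} \<and> (\<forall>g. c g \<in> \<Gamma> g) \<and> x = (\<Sum>g | c g \<noteq> 0. c g)"
    and unique: "\<And>c d. finite {g. c g \<noteq> 0} \<Longrightarrow> finite {g. d g \<noteq> 0} \<Longrightarrow> \<forall>g. c g \<in> \<Gamma> g \<Longrightarrow>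
      \<forall>g. d g \<in> \<Gamma> g \<Longrightarrow> (\<Sum>g | c g \<noteq> 0. c g) = (\<Sum>g | d g \<noteq> 0. d g) \<Longrightarrow> c = d"
  shows "direct_sum_decomposition S \<Gamma>"
  unfolding direct_sum_decomposition_def
proof (intro conjI allI ballI)
  fix x assume "x \<in> S"
  then obtain c where c: "finite {g. c g \<noteq> 0} \<and> (\<forall>g. c g \<in> \<Gamma> g) \<and> x = (\<Sum>g | c g \<noteq> 0. c g)"
    by (elim exE[OF ex]) (rule that)
  show "\<exists>!c. finite {g. c g \<noteq> 0} \<and> (\<forall>g. c g \<in> \<Gamma> g) \<and> x = (\<Sum>g | c g \<noteq> 0. c g)"
  proof (rule ex1I[where a = c], rule c)
    fix d assume d: "finite {g. d g \<noteq> 0} \<and> (\<forall>g. d g \<in> \<Gamma> g) \<and> x = (\<Sum>g | d g \<noteq> 0. d g)"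
    show "d = c"
    proof (rule unique)
      show "(\<Sum>g | d g \<noteq> 0. d g) = (\<Sum>g | c g \<noteq> 0. c g)"
        by (rule trans[OF d[THEN conjunct2, THEN conjunct2, symmetric]
              c[THEN conjunct2, THEN conjunct2]])
    qed (rule c[THEN conjunct1] d[THEN conjunct1] c[THEN conjunct2, THEN conjunct1]
          d[THEN conjunct2, THEN conjunct1])+
  qed
qed (rule sub)+

text \<open>Closure under taking components gives existence; uniqueness is inherited from the
  decomposition of \<open>S\<close>.\<close>

lemma direct_sum_decomposition_induced:
  assumes D: "direct_sum_decomposition S \<Gamma>" and F: "subspace F" "F \<subseteq> S"
    and comp: "\<And>x g. x \<in> F \<Longrightarrow> component \<Gamma> x g \<in> F"
  shows "direct_sum_decomposition F (induced_grading \<Gamma> F)"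
proof (rule direct_sum_decompositionI)
  show "subspace (induced_grading \<Gamma> F g)" "induced_grading \<Gamma> F g \<subseteq> F" for g
    using D F by (auto simp: induced_grading_def direct_sum_decomposition_def subspace_inter)
next
  fix x assume x: "x \<in> F"
  then have xS: "x \<in> S" using F by blast
  show "\<exists>c. finite {g. c g \<noteq> 0} \<and> (\<forall>g. c g \<in> induced_grading \<Gamma> F g) \<and> x = (\<Sum>g | c g \<noteq> 0. c g)"
    using component[OF D xS] comp[OF x]
    by (intro exI[of _ "component \<Gamma> x"]) (simp add: induced_grading_def)
next
  fix c d assume *: "finite {g. c g \<noteq> 0}" "finite {g. d g \<noteq> 0}"
    "\<forall>g. c g \<in> induced_grading \<Gamma> F g" "\<forall>g. d g \<in> induced_grading \<Gamma> F g"
    "(\<Sum>g | c g \<noteq> 0. c g) = (\<Sum>g | d g \<noteq> 0. d g)"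
  have comp: "component \<Gamma> (\<Sum>g | c g \<noteq> 0. c g) = c"
    if "finite {g. c g \<noteq> 0}" "\<forall>g. c g \<in> induced_grading \<Gamma> F g" for c
  proof (rule component_unique[OF D _ that(1)])
    show "(\<Sum>g | c g \<noteq> 0. c g) \<in> S"
      using that(2) F by (intro set_mp[OF F(2)] subspace_sum) (auto simp: induced_grading_def)
    show "c g \<in> \<Gamma> g" for g using that(2) by (simp add: induced_grading_def)
  qed simp_all
  have "c = component \<Gamma> (\<Sum>g | c g \<noteq> 0. c g)" by (rule comp[OF *(1,3), symmetric])
  also have "\<dots> = component \<Gamma> (\<Sum>g | d g \<noteq> 0. d g)" by (rule arg_cong[OF *(5)])
  also have "\<dots> = d" by (rule comp[OF *(2,4)])
  finally show "c = d" .
qed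

text \<open>Serves to obtain directness of the sum of tensor subspaces from that of the original
  grading, along the multiplication map.\<close>

lemma direct_sum_decomposition_pullback:
  fixes \<phi> :: "'a::real_vector \<Rightarrow> 'b::real_vector"
  assumes D: "direct_sum_decomposition S \<Gamma>" and \<phi>: "linear \<phi>" "bij_betw \<phi> T S" and T: "subspace T"
    and \<Delta>: "\<And>g. subspace (\<Delta> g)" "\<And>g. \<Delta> g \<subseteq> T" "\<And>g. \<phi> ` \<Delta> g = \<Gamma> g"
  shows "direct_sum_decomposition T \<Delta>"
proof (rule direct_sum_decompositionI[OF \<Delta>(1,2)])
  have inj: "x = y" if "x \<in> T" "y \<in> T" "\<phi> x = \<phi> y" for x y
    using \<phi>(2) that by (auto simp: bij_betw_def inj_on_def)
  have \<phi>0: "\<phi> x = 0 \<longleftrightarrow> x = 0" if "x \<in> T" for x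
    using inj[OF that subspace_0[OF T]] linear_0[OF \<phi>(1)] by auto
  have \<phi>S: "\<phi> x \<in> S" if "x \<in> T" for x using \<phi>(2) that by (auto simp: bij_betw_def)
  have \<phi>_supp: "{g. \<phi> (c g) \<noteq> 0} = {g. c g \<noteq> 0}" if "\<forall>g. c g \<in> \<Delta> g" for c
    using \<phi>0 \<Delta>(2) that by blast
  have sum_T: "(\<Sum>g | c g \<noteq> 0. c g) \<in> T" if "\<forall>g. c g \<in> \<Delta> g" for c
    using that \<Delta>(2) by (intro subspace_sum[OF T]) blast
  {
    fix x assume x: "x \<in> T"
    note c = component[OF D \<phi>S[OF x]]
    have "\<exists>y. y \<in> \<Delta> g \<and> \<phi> y = component \<Gamma> (\<phi> x) g" for g
      using c(2)[of g] unfolding \<Delta>(3)[symmetric] by (elim imageE) auto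
    then obtain d where d: "\<And>g. d g \<in> \<Delta> g" "\<And>g. \<phi> (d g) = component \<Gamma> (\<phi> x) g" by metis
    have supp: "{g. component \<Gamma> (\<phi> x) g \<noteq> 0} = {g. d g \<noteq> 0}"
      using \<phi>_supp[of d] d by simp
    have "\<phi> (\<Sum>g | d g \<noteq> 0. d g) = \<phi> x"
      using c(3) by (simp add: linear_sum[OF \<phi>(1)] d supp)
    then have "x = (\<Sum>g | d g \<noteq> 0. d g)" using inj sum_T x d by metis
    then show "\<exists>c. finite {g. c g \<noteq> 0} \<and> (\<forall>g. c g \<in> \<Delta> g) \<and> x = (\<Sum>g | c g \<noteq> 0. c g)"
      using c(1) d(1) unfolding supp by (intro exI[of _ d] conjI allI)
  }
  fix c d assume *: "finite {g. c g \<noteq> 0}" "finite {g. d g \<noteq> 0}"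
    "\<forall>g. c g \<in> \<Delta> g" "\<forall>g. d g \<in> \<Delta> g" "(\<Sum>g | c g \<noteq> 0. c g) = (\<Sum>g | d g \<noteq> 0. d g)"
  have eq: "component \<Gamma> (\<phi> (\<Sum>g | c g \<noteq> 0. c g)) = (\<lambda>g. \<phi> (c g))"
    if "finite {g. c g \<noteq> 0}" "\<forall>g. c g \<in> \<Delta> g" for c
  \<comment> \<open>The images of the summands are the components of the image of their sum, so two
    families with equal sums have equal images; injectivity finishes.\<close>
  proof (rule component_unique[OF D \<phi>S[OF sum_T[OF that(2)]] that(1)])
    show "g \<in> {g. c g \<noteq> 0}" if "\<phi> (c g) \<noteq> 0" for g using that linear_0[OF \<phi>(1)] by auto
    show "\<phi> (c g) \<in> \<Gamma> g" for g using that(2) \<Delta>(3) by blast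
  qed (rule linear_sum[OF \<phi>(1)])
  have "(\<lambda>g. \<phi> (c g)) = (\<lambda>g. \<phi> (d g))"
    using eq[OF *(1,3)] eq[OF *(2,4)] *(5) by simp
  then have "\<phi> (c g) = \<phi> (d g)" for g by (rule fun_cong)
  then show "c = d" using *(3,4) \<Delta>(2) inj by (intro ext) blast
qed

section \<open>Division gradings of the whole algebra: components, unit and inverses\<close>

locale division_graded =
  fixes \<Gamma> :: "'g::ab_group_add \<Rightarrow> 'a::real_algebra_1 set"
  assumes division_grading: "division_grading UNIV \<Gamma>"
begin

lemma decomposition: "direct_sum_decomposition UNIV \<Gamma>"
  using division_grading by (simp add: division_grading_def grading_def)

lemma subspace_\<Gamma>: "subspace (\<Gamma> g)"
  using decomposition by (simp add: direct_sum_decomposition_def)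

lemma mult_mem: "x \<in> \<Gamma> g \<Longrightarrow> y \<in> \<Gamma> h \<Longrightarrow> x * y \<in> \<Gamma> (g + h)"
  using division_grading by (simp add: division_grading_def grading_def)

lemma component_homogeneous:
  assumes "x \<in> \<Gamma> g"
  shows "component \<Gamma> x g = x"
proof -
  have "component \<Gamma> x = (\<lambda>h. if h = g then x else 0)"
    by (rule component_unique[OF decomposition, of _ "{g}"])
      (auto simp: assms subspace_0[OF subspace_\<Gamma>] split: if_splits)
  then show ?thesis by simp
qed

text \<open>Meant for left and right multiplication by an element of degree \<open>g\<close>.
  Applying \<open>L\<close> to the summands of \<open>x\<close> yields a homogeneous decomposition
  of \<open>L x\<close>, and decompositions are unique.\<close>

lemma component_shift:
  assumes L: "linear L" and shift: "\<And>y h. y \<in> \<Gamma> h \<Longrightarrow> L y \<in> \<Gamma> (h + g)"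
  shows "component \<Gamma> (L x) h = L (component \<Gamma> x (h - g))"
proof -
  note c = component[OF decomposition UNIV_I, of x]
  let ?K = "{h. component \<Gamma> x h \<noteq> 0}"
  have "component \<Gamma> (L x) = (\<lambda>h. L (component \<Gamma> x (h - g)))"
  proof (rule component_unique[OF decomposition UNIV_I])
    show "finite ((\<lambda>h. h + g) ` ?K)" using c(1) by simp
    show "h \<in> (\<lambda>h. h + g) ` ?K" if "L (component \<Gamma> x (h - g)) \<noteq> 0" for h
      using that linear_0[OF L] by (intro image_eqI[of _ _ "h - g"]) auto
    show "L (component \<Gamma> x (h - g)) \<in> \<Gamma> h" for h
      using shift[OF c(2)[of "h - g"]] by simp
    have "L x = (\<Sum>h\<in>?K. L (component \<Gamma> x h))"
      by (subst c(3)) (rule linear_sum[OF L])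
    also have "\<dots> = (\<Sum>h\<in>(\<lambda>h. h + g) ` ?K. L (component \<Gamma> x (h - g)))"
      by (subst sum.reindex) (auto simp: inj_on_def)
    finally show "L x = (\<Sum>h\<in>(\<lambda>h. h + g) ` ?K. L (component \<Gamma> x (h - g)))" .
  qed
  then show ?thesis by simp
qed

lemma component_mult_left:
  assumes "y \<in> \<Gamma> g"
  shows "component \<Gamma> (y * x) h = y * component \<Gamma> x (h - g)"
proof (rule component_shift)
  show "linear ((*) y)" by (rule linearI) (simp_all add: distrib_left)
  show "y * z \<in> \<Gamma> (h + g)" if "z \<in> \<Gamma> h" for z h
    using mult_mem[OF assms that] by (simp add: add.commute)
qed

lemma component_mult_right:
  assumes "y \<in> \<Gamma> g"
  shows "component \<Gamma> (x * y) h = component \<Gamma> x (h - g) * y"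
proof (rule component_shift[where L = "\<lambda>x. x * y"])
  show "linear (\<lambda>x. x * y)" by (rule linearI) (simp_all add: distrib_right)
  show "z * y \<in> \<Gamma> (h + g)" if "z \<in> \<Gamma> h" for z h
    by (rule mult_mem[OF that assms])
qed

text \<open>Comparing degrees in y * 1 = y shows that the neutral component of 1 is a right unit for
  homogeneous \<open>y\<close>. Summing over the components of 1, it is 1 itself.\<close>

lemma one_mem: "1 \<in> \<Gamma> 0"
proof -
  note c = component[OF decomposition UNIV_I]
  let ?e = "component \<Gamma> 1 0"
  have e: "y * ?e = y" if "y \<in> \<Gamma> h" for y h
    using component_mult_left[OF that, of 1 h] component_homogeneous[OF that] by simp
  have "1 * ?e = (\<Sum>g | component \<Gamma> 1 g \<noteq> 0. component \<Gamma> 1 g) * ?e"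
    using c(3)[of 1] by simp
  also have "\<dots> = (\<Sum>g | component \<Gamma> 1 g \<noteq> 0. component \<Gamma> 1 g)"
    unfolding sum_distrib_right by (rule sum.cong[OF refl]) (rule e[OF c(2)])
  also have "\<dots> = 1" using c(3)[of 1] by simp
  finally show ?thesis using c(2)[of 1 0] by simp
qed

text \<open>The component of the inverse in degree \<open>- g\<close> is already a right inverse of
  \<open>x\<close>, hence equals the inverse.\<close>

lemma inverse_mem:
  assumes "x \<in> \<Gamma> g" "x \<noteq> 0"
  obtains y where "y \<in> \<Gamma> (- g)" "x * y = 1" "y * x = 1"
proof -
  obtain y where y: "x * y = 1" "y * x = 1"
    using division_grading assms unfolding division_grading_def by blast
  have "x * component \<Gamma> y (- g) = component \<Gamma> (x * y) 0"
    using component_mult_left[OF assms(1), of y 0] by simp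
  also have "\<dots> = 1" using component_homogeneous[OF one_mem] y by simp
  finally have "y * (x * component \<Gamma> y (- g)) = y" by simp
  then have "component \<Gamma> y (- g) = y" using y by (simp flip: mult.assoc)
  then show ?thesis using component[OF decomposition UNIV_I, of y] that y by metis
qed

lemma subalgebra_neutral: "subalgebra (\<Gamma> 0)"
  using subspace_\<Gamma> mult_mem[of _ 0 _ 0] by (simp add: subalgebra_def)

lemma neutral_no_zero_divisors:
  assumes "x \<in> \<Gamma> 0" "x * y = 0"
  shows "x = 0 \<or> y = 0"
proof (rule disjCI)
  assume "y \<noteq> 0"
  show "x = 0"
  proof (rule ccontr)
    assume "x \<noteq> 0"
    then obtain z where "z * x = 1" using inverse_mem[OF assms(1)] by blast
    then have "y = z * (x * y)" by (simp flip: mult.assoc)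
    then show False using assms \<open>y \<noteq> 0\<close> by simp
  qed
qed

text \<open>Multiplication by an element of degree 0 preserves degrees, so a x = x a can be compared
  degree by degree.\<close>

lemma component_centralizer:
  assumes "x \<in> centralizer (\<Gamma> 0)"
  shows "component \<Gamma> x g \<in> centralizer (\<Gamma> 0)"
proof -
  have "component \<Gamma> x g * a = a * component \<Gamma> x g" if a: "a \<in> \<Gamma> 0" for a
    using component_mult_left[OF a, of x g] component_mult_right[OF a, of x g] assms a
    by (simp add: centralizer_def)
  then show ?thesis by (simp add: centralizer_def)
qed

end

section \<open>Centralizers, and the grading induced on the centralizer of the neutral
  component\<close>

lemma subspace_centralizer: "subspace (centralizer X)"
  by (auto simp: subspace_def centralizer_def algebra_simps)

lemma mult_mem_centralizer: "x \<in> centralizer X \<Longrightarrow> y \<in> centralizer X \<Longrightarrow> x * y \<in> centralizer X"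
  unfolding centralizer_def by (auto simp: mult.assoc) (metis mult.assoc)

lemma subalgebra_centralizer: "subalgebra (centralizer X)"
  by (simp add: subalgebra_def subspace_centralizer mult_mem_centralizer)

context division_graded
begin

lemma graded_subalgebra_centralizer: "graded_subalgebra UNIV \<Gamma> (centralizer (\<Gamma> 0))"
  unfolding graded_subalgebra_def
  by (intro conjI subalgebra_centralizer subset_UNIV component_centralizer
      direct_sum_decomposition_induced[OF decomposition subspace_centralizer])

lemma division_grading_centralizer:
  "division_grading (centralizer (\<Gamma> 0)) (induced_grading \<Gamma> (centralizer (\<Gamma> 0)))"
  unfolding division_grading_def grading_def
proof (intro conjI allI ballI impI)
  let ?C = "centralizer (\<Gamma> 0)"
  show "subalgebra ?C" "direct_sum_decomposition ?C (induced_grading \<Gamma> ?C)"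
    using graded_subalgebra_centralizer by (simp_all add: graded_subalgebra_def)
  show "1 \<in> ?C" by (simp add: centralizer_def)
  show "x * y \<in> induced_grading \<Gamma> ?C (g + h)"
    if "x \<in> induced_grading \<Gamma> ?C g" "y \<in> induced_grading \<Gamma> ?C h" for x y g h
    using that mult_mem mult_mem_centralizer by (auto simp: induced_grading_def)
  fix g x assume x: "x \<in> induced_grading \<Gamma> ?C g" "x \<noteq> 0"
  then obtain y where y: "x * y = 1" "y * x = 1"
    using inverse_mem[of x g] by (auto simp: induced_grading_def)
  have "y * a = a * y" if a: "a \<in> \<Gamma> 0" for a
  proof -
    have "y * a = y * (a * x) * y" using y by (simp add: mult.assoc)
    also have "\<dots> = y * (x * a) * y" using x a by (simp add: induced_grading_def centralizer_def)
    also have "\<dots> = a * y" using y by (simp flip: mult.assoc)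
    finally show ?thesis .
  qed
  then show "\<exists>y\<in>?C. x * y = 1 \<and> y * x = 1" using y by (auto simp: centralizer_def)
qed

end

section \<open>Splitting off the quaternions\<close>

lemma tens_mem_tensor_sub: "x \<in> S \<Longrightarrow> y \<in> T \<Longrightarrow> tens x y \<in> tensor_sub S T"
  unfolding tensor_sub_def by (rule span_base) blast

lemma subspace_tensor_sub: "subspace (tensor_sub S T)"
  by (simp add: tensor_sub_def)

lemma tensor_sub_mono: "T \<subseteq> T' \<Longrightarrow> tensor_sub S T \<subseteq> tensor_sub S T'"
  unfolding tensor_sub_def by (rule span_mono) blast

lemma tensor_sub_induct [consumes 1, case_names tens subspace]:
  assumes "t \<in> tensor_sub S T" "\<And>x y. x \<in> S \<Longrightarrow> y \<in> T \<Longrightarrow> P (tens x y)" "subspace {t. P t}"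
  shows "P t"
  using span_induct[of t _ P] assms unfolding tensor_sub_def by blast

lemma tensor_sub_mult:
  assumes "s \<in> tensor_sub S T" "t \<in> tensor_sub S' T'"
    and "\<And>x x'. x \<in> S \<Longrightarrow> x' \<in> S' \<Longrightarrow> x * x' \<in> S''" "\<And>y y'. y \<in> T \<Longrightarrow> y' \<in> T' \<Longrightarrow> y * y' \<in> T''"
  shows "s * t \<in> tensor_sub S'' T''"
  using assms(1)
proof (induction rule: tensor_sub_induct)
  case (tens x y)
  show ?case using assms(2)
  proof (induction rule: tensor_sub_induct)
    case (tens x' y')
    show ?case unfolding tens_mult_tens
      by (rule tens_mem_tensor_sub) (simp_all add: assms tens \<open>x \<in> S\<close> \<open>y \<in> T\<close>)
  next
    case subspace
    show ?case using subspace_tensor_sub[of S'' T'']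
      by (auto simp: subspace_def algebra_simps)
  qed
next
  case subspace
  show ?case using subspace_tensor_sub[of S'' T'']
    by (auto simp: subspace_def algebra_simps)
qed

lemma bilinear_mult: "bilinear (\<lambda>x y :: 'a::real_algebra. x * y)"
  by (rule bilinearI') (simp_all add: algebra_simps)

lemmas linear_tensor_lift_mult = linear_tensor_lift[OF bilinear_mult]

text \<open>On pure tensors this is x x' y y' = x y x' y', which holds because y centralizes x'.
  Hence the restriction to tensors with second factors in the centralizer.\<close>

lemma tensor_lift_mult_mult:
  assumes "s \<in> tensor_sub S (centralizer S)" "t \<in> tensor_sub S (centralizer S)"
  shows "tensor_lift (\<lambda>x y. x * y) (s * t) =
    tensor_lift (\<lambda>x y. x * y) s * tensor_lift (\<lambda>x y. x * y) (t :: ('a::real_algebra, 'a) tensor)"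
  using assms(1)
proof (induction rule: tensor_sub_induct)
  case (tens x y)
  show ?case using assms(2)
  proof (induction rule: tensor_sub_induct)
    case (tens x' y')
    have "y * x' = x' * y" using tens \<open>y \<in> centralizer S\<close> by (simp add: centralizer_def)
    then have "x * x' * (y * y') = x * y * (x' * y')" by (metis mult.assoc)
    then show ?case by (simp add: tens_mult_tens tensor_lift_tens[OF bilinear_mult])
  next
    case subspace
    show ?case
      by (auto simp: subspace_def algebra_simps linear_0[OF linear_tensor_lift_mult]
          linear_add[OF linear_tensor_lift_mult] linear_scale[OF linear_tensor_lift_mult])
  qed
next
  case subspace
  show ?case
    by (auto simp: subspace_def algebra_simps linear_0[OF linear_tensor_lift_mult]
        linear_add[OF linear_tensor_lift_mult] linear_scale[OF linear_tensor_lift_mult])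
qed

section \<open>The centralizer of a quaternionic neutral component\<close>

locale quaternion_graded = quaternion_units i j + division_graded \<Gamma>
  for i j :: "'a::real_algebra_1" and \<Gamma> :: "'g::ab_group_add \<Rightarrow> 'a set" +
  assumes i_mem: "i \<in> \<Gamma> 0" and j_mem: "j \<in> \<Gamma> 0"
    and neutral_coords: "a \<in> \<Gamma> 0 \<Longrightarrow>
      \<exists>\<alpha> \<beta> \<gamma> \<delta>. a = \<alpha> *\<^sub>R 1 + \<beta> *\<^sub>R i + \<gamma> *\<^sub>R j + \<delta> *\<^sub>R (i * j)"
begin

abbreviation C where "C \<equiv> centralizer (\<Gamma> 0)"

text \<open>Commuting with \<open>i\<close> and \<open>j\<close> entails commuting with
  \<open>i * j\<close>, hence with every real combination, and by \<open>neutral_coords\<close>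
  these exhaust the neutral component.\<close>

lemma mem_C_iff: "y \<in> C \<longleftrightarrow> y * i = i * y \<and> y * j = j * y"
proof
  assume "y \<in> C"
  then show "y * i = i * y \<and> y * j = j * y" using i_mem j_mem by (simp add: centralizer_def)
next
  assume y: "y * i = i * y \<and> y * j = j * y"
  then have yk: "y * (i * j) = i * (j * y)" by (metis mult.assoc)
  show "y \<in> C"
    unfolding centralizer_def
  proof (intro CollectI ballI)
    fix a assume "a \<in> \<Gamma> 0"
    then obtain \<alpha> \<beta> \<gamma> \<delta> where a: "a = \<alpha> *\<^sub>R 1 + \<beta> *\<^sub>R i + \<gamma> *\<^sub>R j + \<delta> *\<^sub>R (i * j)"
      using neutral_coords by blast
    show "y * a = a * y" using y yk by (simp add: a algebra_simps)
  qed
qed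

lemma proj_mem_C: "proj c \<in> C"
  by (simp add: mem_C_iff proj_commutes)

lemma neutral_mult_mem:
  assumes "c \<in> \<Gamma> g"
  shows "i * c \<in> \<Gamma> g" "j * c \<in> \<Gamma> g" "c * i \<in> \<Gamma> g" "c * j \<in> \<Gamma> g"
  using mult_mem[OF i_mem assms] mult_mem[OF j_mem assms]
    mult_mem[OF assms i_mem] mult_mem[OF assms j_mem] by simp_all

lemma proj_mem: "c \<in> \<Gamma> g \<Longrightarrow> proj c \<in> \<Gamma> g"
  using neutral_mult_mem unfolding proj_def mult.assoc
  by (intro subspace_scale[OF subspace_\<Gamma>] subspace_diff[OF subspace_\<Gamma>])
    (simp_all flip: mult.assoc[of c])

lemma neutral_center:
  assumes "y \<in> \<Gamma> 0" "y \<in> C"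
  shows "\<exists>r. y = r *\<^sub>R 1"
proof -
  obtain \<alpha> \<beta> \<gamma> \<delta> where a: "y = \<alpha> *\<^sub>R 1 + \<beta> *\<^sub>R i + \<gamma> *\<^sub>R j + \<delta> *\<^sub>R (i * j)"
    using neutral_coords[OF assms(1)] by blast
  have "y = proj y" using assms by (simp add: mem_C_iff proj_commuting)
  \<comment> \<open>The case of the commuting element 1 in \<open>proj_commuting\<close>:
    \<open>proj\<close> keeps the real part and kills i, j and ij.\<close>
  also have "proj y = \<alpha> *\<^sub>R 1"
    using proj_commuting[of 1] by (simp add: a proj_add proj_scaleR)
  finally show ?thesis by blast
qed

text \<open>Dividing by a nonzero \<open>y\<close> of degree \<open>g\<close> moves the component
  into degree 0, where the centralizer consists of real scalars.\<close>

lemma components_of_dim_centralizer: "components_of_dim (induced_grading \<Gamma> C) 1"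
  unfolding components_of_dim_def
proof (intro allI impI)
  fix g assume ne: "induced_grading \<Gamma> C g \<noteq> {0}"
  have "0 \<in> induced_grading \<Gamma> C g"
    using subspace_0[OF subspace_\<Gamma>] subspace_0[OF subspace_centralizer]
    by (simp add: induced_grading_def)
  then obtain y where y: "y \<in> induced_grading \<Gamma> C g" "y \<noteq> 0" using ne by blast
  then obtain z where z: "z \<in> \<Gamma> (- g)" "y * z = 1" using inverse_mem[of y g]
    by (auto simp: induced_grading_def)
  \<comment> \<open>One inverse of \<open>y\<close> is known to be homogeneous, another to lie in
    the centralizer; by uniqueness of inverses they coincide and have both properties.\<close>
  obtain z' where z': "z' \<in> C" "z' * y = 1"
    using division_grading_centralizer y unfolding division_grading_def by metis
  have "z = z'" using z z' by (metis mult.assoc mult.left_neutral mult.right_neutral)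
  have "x \<in> span {y}" if x: "x \<in> induced_grading \<Gamma> C g" for x
  proof -
    have "z * x \<in> \<Gamma> 0" "z * x \<in> C"
      using mult_mem[OF z(1), of x g] mult_mem_centralizer[OF z'(1), of x] x \<open>z = z'\<close>
      by (simp_all add: induced_grading_def)
    then obtain r where "z * x = r *\<^sub>R 1" using neutral_center by blast
    then have "y * (z * x) = r *\<^sub>R y" by simp
    then have "x = r *\<^sub>R y" using z by (simp flip: mult.assoc)
    then show ?thesis by (simp add: span_base span_scale)
  qed
  then have "dim (induced_grading \<Gamma> C g) = card {y}"
    using y by (intro dim_unique[of "{y}"]) auto
  then show "dim (induced_grading \<Gamma> C g) = 1" by simp
qed

section \<open>The inverse of the multiplication map\<close>

text \<open>The expansion \<open>proj_expand\<close> with its products replaced by tensors, so that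
  multiplying out returns \<open>c\<close>.\<close>

definition unmult :: "'a \<Rightarrow> ('a, 'a) tensor" where
  "unmult c = tens 1 (proj c) - tens i (proj (i * c)) - tens j (proj (j * c))
     - tens (i * j) (proj (i * j * c))"

lemma proj_minus: "proj (- c) = - proj c"
  using proj_scaleR[of "- 1" c] by simp

lemma linear_unmult: "linear unmult"
  by (rule linearI)
    (simp_all add: unmult_def proj_add proj_scaleR tens_simps algebra_simps)

lemma mult_unmult: "tensor_lift (\<lambda>x y. x * y) (unmult c) = c"
  by (simp only: unmult_def linear_diff[OF linear_tensor_lift_mult] tensor_lift_tens[OF bilinear_mult]
      proj_expand mult_1_left)

lemma unmult_mult:
  assumes a: "a \<in> \<Gamma> 0" and y: "y \<in> C"
  shows "unmult (a * y) = tens a y"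
proof -
  obtain \<alpha> \<beta> \<gamma> \<delta> where a: "a = \<alpha> *\<^sub>R 1 + \<beta> *\<^sub>R i + \<gamma> *\<^sub>R j + \<delta> *\<^sub>R (i * j)"
    using neutral_coords[OF a] by blast
  have y': "y * i = i * y" "y * j = j * y" using y by (simp_all add: mem_C_iff)
  \<comment> \<open>By linearity only a = 1, i, j, ij matter. For each of them,
    \<open>proj_commuting\<close> annihilates three of the four tensors, and the square -1 of the
    unit cancels the minus sign of the remaining one when a is not 1.\<close>
  have "unmult y = tens 1 y" "unmult (i * y) = tens i y" "unmult (j * y) = tens j y"
    "unmult (i * (j * y)) = tens (i * j) y"
    by (simp_all add: unmult_def unit_simps proj_commuting[OF y'] proj_minus
        bilinear_rzero[OF bilinear_tens] bilinear_rneg[OF bilinear_tens])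
  then show ?thesis
    by (simp add: a distrib_right mult.assoc linear_add[OF linear_unmult]
        linear_scale[OF linear_unmult] tens_simps)
qed

lemma unmult_tensor_lift:
  assumes "t \<in> tensor_sub (\<Gamma> 0) C"
  shows "unmult (tensor_lift (\<lambda>x y. x * y) t) = t"
  using assms
proof (induction rule: tensor_sub_induct)
  case (tens x y)
  then show ?case by (simp add: tensor_lift_tens[OF bilinear_mult] unmult_mult)
next
  case subspace
  show ?case
    by (auto simp: subspace_def linear_0[OF linear_tensor_lift_mult] linear_0[OF linear_unmult]
        linear_add[OF linear_tensor_lift_mult] linear_add[OF linear_unmult]
        linear_scale[OF linear_tensor_lift_mult] linear_scale[OF linear_unmult])
qed

text \<open>\<open>proj\<close> preserves degrees and lands in the centralizer. This makes
  multiplication surjective onto each homogeneous component.\<close>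

lemma unmult_mem:
  assumes "c \<in> \<Gamma> g"
  shows "unmult c \<in> tensor_sub (\<Gamma> 0) (\<Gamma> g \<inter> C)"
  unfolding unmult_def
  by (intro subspace_diff[OF subspace_tensor_sub] tens_mem_tensor_sub)
    (use one_mem i_mem j_mem mult_mem[OF i_mem j_mem] assms in
      \<open>simp_all add: proj_mem proj_mem_C neutral_mult_mem mult.assoc\<close>)

lemma unmult_mem_C: "unmult c \<in> tensor_sub (\<Gamma> 0) C"
  unfolding unmult_def
  by (intro subspace_diff[OF subspace_tensor_sub] tens_mem_tensor_sub)
    (use one_mem i_mem j_mem mult_mem[OF i_mem j_mem] in \<open>simp_all add: proj_mem_C\<close>)

lemma image_tensor_sub:
  "tensor_lift (\<lambda>x y. x * y) ` tensor_sub (\<Gamma> 0) (\<Gamma> g \<inter> C) = \<Gamma> g"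
proof
  have "tensor_lift (\<lambda>x y. x * y) t \<in> \<Gamma> g" if "t \<in> tensor_sub (\<Gamma> 0) (\<Gamma> g \<inter> C)" for t
    using that
  proof (induction rule: tensor_sub_induct)
    case (tens x y)
    then show ?case using mult_mem[of x 0 y g] by (simp add: tensor_lift_tens[OF bilinear_mult])
  next
    case subspace
    show ?case
      using subspace_\<Gamma>[of g]
      by (auto simp: subspace_def linear_0[OF linear_tensor_lift_mult]
          linear_add[OF linear_tensor_lift_mult] linear_scale[OF linear_tensor_lift_mult])
  qed
  then show "tensor_lift (\<lambda>x y. x * y) ` tensor_sub (\<Gamma> 0) (\<Gamma> g \<inter> C) \<subseteq> \<Gamma> g" by blast
  show "\<Gamma> g \<subseteq> tensor_lift (\<lambda>x y. x * y) ` tensor_sub (\<Gamma> 0) (\<Gamma> g \<inter> C)"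
    using unmult_mem mult_unmult by (metis imageI subsetI)
qed

lemma bij_tensor_lift_mult:
  "bij_betw (tensor_lift (\<lambda>x y. x * y)) (tensor_sub (\<Gamma> 0) C) (UNIV :: 'a set)"
  by (rule bij_betwI[where g = unmult])
    (simp_all add: unmult_mem_C unmult_tensor_lift mult_unmult)

lemma graded_algebra_iso_mult:
  "graded_algebra_iso (tensor_sub (\<Gamma> 0) C)
     (\<lambda>g. product_grading (trivial_grading (\<Gamma> 0)) (induced_grading \<Gamma> C) (0, g))
     UNIV \<Gamma> (tensor_lift (\<lambda>x y. x * y))"
proof -
  have P: "(\<lambda>g. product_grading (trivial_grading (\<Gamma> 0)) (induced_grading \<Gamma> C) (0, g)) =
      (\<lambda>g. tensor_sub (\<Gamma> 0) (\<Gamma> g \<inter> C))"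
    by (simp add: product_grading_def trivial_grading_def induced_grading_def)
  have mult0: "x * y \<in> \<Gamma> 0" if "x \<in> \<Gamma> 0" "y \<in> \<Gamma> 0" for x y
    using mult_mem[OF that] by simp
  have "grading (tensor_sub (\<Gamma> 0) C) (\<lambda>g. tensor_sub (\<Gamma> 0) (\<Gamma> g \<inter> C))"
    unfolding grading_def
  proof (intro conjI allI ballI)
    show "subalgebra (tensor_sub (\<Gamma> 0) C)"
      unfolding subalgebra_def
      using subspace_tensor_sub tensor_sub_mult mult0 mult_mem_centralizer by blast
    \<comment> \<open>Directness is pulled back from \<open>\<Gamma>\<close> along the linear
      bijection given by multiplication.\<close>
    show "direct_sum_decomposition (tensor_sub (\<Gamma> 0) C) (\<lambda>g. tensor_sub (\<Gamma> 0) (\<Gamma> g \<inter> C))"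
      by (rule direct_sum_decomposition_pullback[OF decomposition linear_tensor_lift_mult
            bij_tensor_lift_mult subspace_tensor_sub subspace_tensor_sub _ image_tensor_sub])
        (simp add: tensor_sub_mono)
    show "s * t \<in> tensor_sub (\<Gamma> 0) (\<Gamma> (g + h) \<inter> C)"
      if "s \<in> tensor_sub (\<Gamma> 0) (\<Gamma> g \<inter> C)" "t \<in> tensor_sub (\<Gamma> 0) (\<Gamma> h \<inter> C)" for g h s t
      by (rule tensor_sub_mult[OF that]) (auto simp: mult0 mult_mem mult_mem_centralizer)
  qed
  moreover have "algebra_iso (tensor_sub (\<Gamma> 0) C) (UNIV :: 'a set) (tensor_lift (\<lambda>x y. x * y))"
    unfolding algebra_iso_def
    by (simp add: bij_tensor_lift_mult tensor_lift_mult_mult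
        linear_add[OF linear_tensor_lift_mult] linear_scale[OF linear_tensor_lift_mult])
  moreover have "grading UNIV \<Gamma>" using division_grading by (simp add: division_grading_def)
  ultimately show ?thesis unfolding graded_algebra_iso_def P by (simp add: image_tensor_sub)
qed

end

theorem theorem19:
  fixes \<Gamma> :: "'g::ab_group_add \<Rightarrow> 'a::real_algebra_1 set"
  assumes "finite_dimensional (UNIV :: 'a set)"
    and "simple_algebra (UNIV :: 'a set)"
    and "division_grading UNIV \<Gamma>"
    and "components_of_dim \<Gamma> 4"
  shows "graded_subalgebra UNIV \<Gamma> (centralizer (\<Gamma> 0)) \<and>
    division_grading (centralizer (\<Gamma> 0)) (induced_grading \<Gamma> (centralizer (\<Gamma> 0))) \<and>
    components_of_dim (induced_grading \<Gamma> (centralizer (\<Gamma> 0))) 1 \<and>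
    graded_algebra_iso
      (tensor_sub (\<Gamma> 0) (centralizer (\<Gamma> 0)))
      (\<lambda>g. product_grading (trivial_grading (\<Gamma> 0))
             (induced_grading \<Gamma> (centralizer (\<Gamma> 0))) (0, g))
      UNIV \<Gamma>
      (tensor_lift (\<lambda>x y. x * y))"
proof -
  interpret division_graded \<Gamma> by unfold_locales fact
  \<comment> \<open>The dimension is prescribed only for nonzero components; the unit shows that the
    neutral one is among them.\<close>
  have "\<Gamma> 0 \<noteq> {0}" using one_mem by force
  then have dim: "dim (\<Gamma> 0) > 2" using assms(4) by (simp add: components_of_dim_def)
  have nzd: "\<forall>x\<in>\<Gamma> 0. \<forall>y\<in>\<Gamma> 0. x * y = 0 \<longrightarrow> x = 0 \<or> y = 0"
    using neutral_no_zero_divisors by blast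
  obtain i j where ij: "quaternion_units i j" "i \<in> \<Gamma> 0" "j \<in> \<Gamma> 0"
    and coords: "\<And>a. a \<in> \<Gamma> 0 \<Longrightarrow>
      \<exists>\<alpha> \<beta> \<gamma> \<delta>. a = \<alpha> *\<^sub>R 1 + \<beta> *\<^sub>R i + \<gamma> *\<^sub>R j + \<delta> *\<^sub>R (i * j)"
    by (rule quaternion_units_exist[OF assms(1) subalgebra_neutral one_mem nzd dim]) (rule that)
  interpret quaternion_units i j by (rule ij(1))
  interpret quaternion_graded i j \<Gamma> by unfold_locales (rule ij coords; assumption?)+
  show ?thesis
    by (intro conjI graded_subalgebra_centralizer division_grading_centralizer
        components_of_dim_centralizer graded_algebra_iso_mult)
qed

end
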